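(* Let $k\ge1$. Assume that the projected hydrostatic equilibrium satisfies, for all $K\in\mathcal K_h$ and all $(x,y)\in\mathbb S_K$, $\rho_h^e(x,y)>0$ and $\mathbf z^\top\mathbf p_h^e(x,y)\mathbf z>0$ for all $\mathbf z\in\mathbb R^2\setminus\{\mathbf 0\}$, and that $\mathbf U_h(x,y)\in\mathcal G$ for all $(x,y)\in\mathbb S_K$ and all $K\in\mathcal K_h$. Then the cell averages updated by the two-dimensional well-balanced DG scheme satisfy $$\overline{\mathbf U}_K^{\rm new}\in\mathcal G\qquad\forall K\in\mathcal K_h$$ under the CFL-type condition $$\Delta t\left(\max_{1\le\mu\le N}\left\{\frac{\eta_{1,i+\frac12,l}^{*,-,\mu}}{\omega_1^-\Delta x},\frac{\eta_{1,i-\frac12,l}^{*,+,\mu}}{\omega_1^+\Delta x},\frac{\eta_{2,i,l+\frac12}^{*,\mu,-}}{\omega_2^-\Delta y},\frac{\eta_{2,i,l-\frac12}^{*,\mu,+}}{\omega_2^+\Delta y}\right\}+\beta_{11,K}+\beta_{22,K}\right)\le1,$$ where $$\eta_{1,i+\frac12,l}^{*,-,\mu}=\frac{2}{\xi^*(\mathbf U_{i+\frac12,l}^{-,\mu})}\max_{\mathbf U\in\{\widehat{\mathbf U}_{i+\frac12,l}^{-,\mu},\widehat{\mathbf U}_{i+\frac12,l}^{+,\mu},\widehat{\mathbf U}_{i-\frac12,l}^{+,\mu}\}}\alpha_1(\mathbf U),\quad \eta_{1,i-\frac12,l}^{*,+,\mu}=\frac{2}{\xi^*(\mathbf U_{i-\frac12,l}^{+,\mu})}\max_{\mathbf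 U\in\{\widehat{\mathbf U}_{i-\frac12,l}^{-,\mu},\widehat{\mathbf U}_{i-\frac12,l}^{+,\mu},\widehat{\mathbf U}_{i+\frac12,l}^{-,\mu}\}}\alpha_1(\mathbf U),$$ $$\eta_{2,i,l+\frac12}^{*,\mu,-}=\frac{2}{\xi^*(\mathbf U_{i,l+\frac12}^{\mu,-})}\max_{\mathbf U\in\{\widehat{\mathbf U}_{i,l+\frac12}^{\mu,-},\widehat{\mathbf U}_{i,l+\frac12}^{\mu,+},\widehat{\mathbf U}_{i,l-\frac12}^{\mu,+}\}}\alpha_2(\mathbf U),\quad \eta_{2,i,l-\frac12}^{*,\mu,+}=\frac{2}{\xi^*(\mathbf U_{i,l-\frac12}^{\mu,+})}\max_{\mathbf U\in\{\widehat{\mathbf U}_{i,l-\frac12}^{\mu,-},\widehat{\mathbf U}_{i,l-\frac12}^{\mu,+},\widehat{\mathbf U}_{i,l+\frac12}^{\mu,-}\}}\alpha_2(\mathbf U),$$ $$\beta_{11,K}=\max_{1\le\mu_1,\mu_2\le N}\left|\Big(\frac{(p_{11,h}^e)_x}{\rho_h^e}\delta_1(\mathbf U_h)\Big)_{i,l}^{\mu_1,\mu_2}\right|+\left|\alpha_{11,K}\delta_1(\overline{\mathbf U}_K)\right|,\quad \beta_{22,K}=\max_{1\le\mu_1,\mu_2\le N}\left|\Big(\frac{(p_{22,h}^e)_y}{\rho_h^e}\delta_2(\mathbf U_h)\Big)_{i,l}^{\mu_1,\mu_2}\right|+\left|\alpha_{22,K}\delta_2(\overline{\mathbf U}_K)\right|,$$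 and $$\alpha_{11,K}=\frac{\sum_{\mu}\omega_\mu\big(p_{11,i+\frac12,l}^{e,*,\mu}-p_{11,i-\frac12,l}^{e,*,\mu}-p_{11,i+\frac12,l}^{e,-,\mu}+p_{11,i-\frac12,l}^{e,+,\mu}\big)}{\Delta x\,\overline{(\rho_h^e)}_K},\quad \alpha_{22,K}=\frac{\sum_{\mu}\omega_\mu\big(p_{22,i,l+\frac12}^{e,\mu,*}-p_{22,i,l-\frac12}^{e,\mu,*}-p_{22,i,l+\frac12}^{e,\mu,-}+p_{22,i,l-\frac12}^{e,\mu,+}\big)}{\Delta y\,\overline{(\rho_h^e)}_K}.$$
   Context: **States.** $\mathbf U=(\rho,m_1,m_2,E_{11},E_{12},E_{22})^\top\in\mathbb R^6$, $\mathbf m=(m_1,m_2)^\top$, $\mathbf E$ the symmetric $2\times2$ matrix with entries $E_{11},E_{12},E_{22}$. For $\rho>0$: $\mathbf u=\mathbf m/\rho$, $\mathbf p=(p_{ij})=2\mathbf E-\mathbf m\mathbf m^\top/\rho$. $\mathcal G=\{\mathbf U:\rho>0,\ \mathbf p\text{ positive-definite}\}$ (convex). For $\mathbf U\in\mathcal G$: $\alpha_1(\mathbf U)=|u_1|+\sqrt{3p_{11}/\rho}$, $\alpha_2(\mathbf U)=|u_2|+\sqrt{3p_{22}/\rho}$, $\delta_1(\mathbf U)=\max\{\sqrt{\rho/p_{11}},\sqrt{\rho p_{22}/\det\mathbf p}\}$, $\delta_2(\mathbf U)=\max\{\sqrt{\rho/p_{22}},\sqrt{\rho p_{11}/\det\mathbf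 p}\}$. Also $\mathbf S_1(\mathbf U)=(0,\rho,0,m_1,\frac12m_2,0)^\top$, $\mathbf S_2(\mathbf U)=(0,0,\rho,0,\frac12m_1,m_2)^\top$. **HLLC fluxes.** $\mathbf F^{hllc},\mathbf G^{hllc}:\mathcal G\times\mathcal G\to\mathbb R^6$ are the HLLC numerical fluxes of the ten-moment Gaussian closure system in the $x$- and $y$-directions. Known property: for $\mathbf U_L,\mathbf U_M,\mathbf U_R\in\mathcal G$ and $\lambda>0$ with $\lambda\max_{\mathbf U\in\{\mathbf U_L,\mathbf U_M,\mathbf U_R\}}\alpha_1(\mathbf U)\le\frac12$, $\mathbf U_M-\lambda(\mathbf F^{hllc}(\mathbf U_M,\mathbf U_R)-\mathbf F^{hllc}(\mathbf U_L,\mathbf U_M))\in\mathcal G$; the same holds for $\mathbf G^{hllc}$ with $\alpha_2$ in place of $\alpha_1$. **Mesh.** Uniform Cartesian mesh $\mathcal K_h$, cells $K=[x_{i-\frac12},x_{i+\frac12}]\times[y_{l-\frac12},y_{l+\frac12}]$ of sides $\Delta x,\Delta y$; $\mathbb V_h^k$: polynomials of total degree $\le k$ (space $\mathbb P^k(K)$) on each $K$; superscripts $\mp$ at an interface coordinate are limits from the left/below ($-$) and right/above ($+$). Every cell has neighbours (ghost cells at the boundary satisfying the same hypotheses). $x_i^{(\mu)},y_l^{(\mu)}$ ($1\le\mu\le N$): Gauss nodes in the two intervals, weights $\omega_\mu$, $\sum_\mu\omega_\mu=1$, rule exact for degree $\le k$ ($2N-1\ge k$). $(\cdot)_{i,l}^{\mu_1,\mu_2}$: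 value at $(x_i^{(\mu_1)},y_l^{(\mu_2)})$; $\overline{(\cdot)}_K$: cell average. $\mathbf U_{i+\frac12,l}^{\pm,\mu}=\mathbf U_h(x_{i+\frac12}^\pm,y_l^{(\mu)})$, $\mathbf U_{i,l+\frac12}^{\mu,\pm}=\mathbf U_h(x_i^{(\mu)},y_{l+\frac12}^\pm)$. **Feasible decomposition.** Fixed weights $\omega_1^\pm,\omega_2^\pm,\widetilde\omega_s>0$ with $\omega_1^-+\omega_1^++\omega_2^-+\omega_2^++\sum_{s=1}^S\widetilde\omega_s=1$ and points $(x_K^{(s)},y_K^{(s)})\in K$ are such that, for all polynomials in $\mathbb P^k(K)$, $$\overline{\mathbf U}_K=\sum_{\mu=1}^N\omega_\mu\big(\omega_1^-\mathbf U_{i+\frac12,l}^{-,\mu}+\omega_1^+\mathbf U_{i-\frac12,l}^{+,\mu}+\omega_2^-\mathbf U_{i,l+\frac12}^{\mu,-}+\omega_2^+\mathbf U_{i,l-\frac12}^{\mu,+}\big)+\sum_{s=1}^S\widetilde\omega_s\mathbf U_h(x_K^{(s)},y_K^{(s)}).$$ $\mathbb S_K$ is the set of all points $(x_{i+\frac12}^-,y_l^{(\mu)}),(x_{i-\frac12}^+,y_l^{(\mu)}),(x_i^{(\mu)},y_{l+\frac12}^-),(x_i^{(\mu)},y_{l-\frac12}^+)$ ($1\le\mu\le N$), $(x_K^{(s)},y_K^{(s)})$ ($1\le s\le S$), $(x_i^{(\mu_1)},y_l^{(\mu_2)})$ ($1\le\mu_1,\mu_2\le N$), with values taken from inside $K$.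 **Projected equilibrium.** $\rho_h^e,p_{11,h}^e,p_{22,h}^e\in\mathbb V_h^k$ given, $C_0$ a constant, $\mathbf p_h^e=\begin{pmatrix}p_{11,h}^e&C_0\\C_0&p_{22,h}^e\end{pmatrix}$. $p_{11,i+\frac12,l}^{e,\pm,\mu}=p_{11,h}^e(x_{i+\frac12}^\pm,y_l^{(\mu)})$, $p_{22,i,l+\frac12}^{e,\mu,\pm}=p_{22,h}^e(x_i^{(\mu)},y_{l+\frac12}^\pm)$, $p_{11,i+\frac12,l}^{e,*,\mu}=\max\{p_{11,i+\frac12,l}^{e,-,\mu},p_{11,i+\frac12,l}^{e,+,\mu}\}$, $p_{22,i,l+\frac12}^{e,\mu,*}=\max\{p_{22,i,l+\frac12}^{e,\mu,-},p_{22,i,l+\frac12}^{e,\mu,+}\}$. **Transformation matrices.** At $(x_{i+\frac12}^\pm,y_l^{(\mu)})$: $\mathbf T=\begin{pmatrix}t_1&t_2\\0&1\end{pmatrix}$, where $\mathbf p^*$ denotes $\mathbf p_h^e(x_{i+\frac12}^\pm,y_l^{(\mu)})$ with its $(1,1)$ entry replaced by $p_{11,i+\frac12,l}^{e,*,\mu}$, $t_1=\sqrt{\det\mathbf p^*/\det\mathbf p_h^e(x_{i+\frac12}^\pm,y_l^{(\mu)})}$, $t_2=C_0(1-t_1)/p_{22,h}^e(x_{i+\frac12}^\pm,y_l^{(\mu)})$. At $(x_i^{(\mu)},y_{l+\frac12}^\pm)$: $\mathbf T=\begin{pmatrix}1&0\\t_4&t_3\end{pmatrix}$, where $\mathbf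 p^*$ denotes $\mathbf p_h^e(x_i^{(\mu)},y_{l+\frac12}^\pm)$ with its $(2,2)$ entry replaced by $p_{22,i,l+\frac12}^{e,\mu,*}$, $t_3=\sqrt{\det\mathbf p^*/\det\mathbf p_h^e(x_i^{(\mu)},y_{l+\frac12}^\pm)}$, $t_4=C_0(1-t_3)/p_{11,h}^e(x_i^{(\mu)},y_{l+\frac12}^\pm)$. The modified state $\widehat{\mathbf U}$ at such an edge point is obtained from $\mathbf U$ at that point by $\widehat\rho=\rho$, $\widehat{\mathbf m}=\mathbf T\mathbf m$, $\widehat{\mathbf E}=\mathbf T\mathbf E\mathbf T^\top$. **The quantity $\xi^*$.** For $\mathbf U\in\mathcal G$ at an edge point with matrix $\mathbf T$: $f^{(1)}=\|\mathbf p^{-1/2}\mathbf T\mathbf p^{1/2}\|_2^2$. If $\mathbf T=\begin{pmatrix}t_1&t_2\\0&1\end{pmatrix}$, put $q=((1-t_1)m_1-t_2m_2)^2$, $f^{(2)}=\frac q{\rho p_{11}}$, $f^{(3)}=\frac{q\,p_{22}}{\rho\det\mathbf p}$. If $\mathbf T=\begin{pmatrix}1&0\\t_4&t_3\end{pmatrix}$, put $q=((1-t_3)m_2-t_4m_1)^2$, $f^{(2)}=\frac q{\rho p_{22}}$, $f^{(3)}=\frac{q\,p_{11}}{\rho\det\mathbf p}$. Then $\theta_{1,\ell}=\frac12\big(\sqrt{(f^{(1)}+f^{(\ell)}-1)^2+4f^{(\ell)}}-(f^{(1)}+f^{(\ell)}-1)\big)$, $\ell=2,3$, $\theta_*=\max\{\theta_{1,2},\theta_{1,3}\}$,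 $\xi^*(\mathbf U)=\frac{1-\theta_*}{f^{(1)}}$. **Cell-average update** (the scheme with forward Euler step $\Delta t>0$ and test function $v=1$): $$\overline{\mathbf U}_K^{\rm new}=\overline{\mathbf U}_K-\frac{\Delta t}{\Delta x}\sum_\mu\omega_\mu\big[\mathbf F^{hllc}(\widehat{\mathbf U}_{i+\frac12,l}^{-,\mu},\widehat{\mathbf U}_{i+\frac12,l}^{+,\mu})-\mathbf F^{hllc}(\widehat{\mathbf U}_{i-\frac12,l}^{-,\mu},\widehat{\mathbf U}_{i-\frac12,l}^{+,\mu})\big]-\frac{\Delta t}{\Delta y}\sum_\mu\omega_\mu\big[\mathbf G^{hllc}(\widehat{\mathbf U}_{i,l+\frac12}^{\mu,-},\widehat{\mathbf U}_{i,l+\frac12}^{\mu,+})-\mathbf G^{hllc}(\widehat{\mathbf U}_{i,l-\frac12}^{\mu,-},\widehat{\mathbf U}_{i,l-\frac12}^{\mu,+})\big]+\Delta t\,\overline{\mathbf S}_K^x+\Delta t\,\overline{\mathbf S}_K^y,$$ $$\overline{\mathbf S}_K^x=\sum_{\mu_1,\mu_2}\omega_{\mu_1}\omega_{\mu_2}\Big(\frac{(p_{11,h}^e)_x}{\rho_h^e}\mathbf S_1(\mathbf U_h)\Big)_{i,l}^{\mu_1,\mu_2}+\alpha_{11,K}\mathbf S_1(\overline{\mathbf U}_K),\quad \overline{\mathbf S}_K^y=\sum_{\mu_1,\mu_2}\omega_{\mu_1}\omega_{\mu_2}\Big(\frac{(p_{22,h}^e)_y}{\rho_h^e}\mathbf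 S_2(\mathbf U_h)\Big)_{i,l}^{\mu_1,\mu_2}+\alpha_{22,K}\mathbf S_2(\overline{\mathbf U}_K),$$ with $\alpha_{11,K},\alpha_{22,K}$ as given in the claim. *)

theory Defs
  imports "HOL-Analysis.Analysis"
begin

section \<open>States of the ten-moment system\<close>

text \<open>A state is the vector (rho, m1, m2, E11, E12, E22).\<close>

type_synonym state = "real^6"

definition rho :: "state \<Rightarrow> real" where "rho U = U $ 1"

definition mom :: "state \<Rightarrow> real^2" where "mom U = vector [U $ 2, U $ 3]"

definition mat2 :: "real \<Rightarrow> real \<Rightarrow> real \<Rightarrow> real \<Rightarrow> real^2^2" where
  "mat2 a b c d = vector [vector [a, b], vector [c, d]]"

definition energy :: "state \<Rightarrow> real^2^2" where
  "energy U = mat2 (U $ 4) (U $ 5) (U $ 5) (U $ 6)"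

definition mk_state :: "real \<Rightarrow> real^2 \<Rightarrow> real^2^2 \<Rightarrow> state" where
  "mk_state r m E = vector [r, m $ 1, m $ 2, E $ 1 $ 1, E $ 1 $ 2, E $ 2 $ 2]"

definition velocity :: "state \<Rightarrow> real^2" where
  "velocity U = (1 / rho U) *\<^sub>R mom U"

definition pressure :: "state \<Rightarrow> real^2^2" where
  "pressure U = (\<chi> i j. 2 * energy U $ i $ j - mom U $ i * mom U $ j / rho U)"

text \<open>Symmetry is not part of this predicate; every matrix it is applied to below is symmetric
  by construction.\<close>

definition pos_def :: "real^'n^'n \<Rightarrow> bool" where
  "pos_def A \<longleftrightarrow> (\<forall>z. z \<noteq> 0 \<longrightarrow> z \<bullet> (A *v z) > 0)"

definition admissible :: "state set" where
  "admissible = {U. rho U > 0 \<and> pos_def (pressure U)}"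

definition alpha1 :: "state \<Rightarrow> real" where
  "alpha1 U = \<bar>velocity U $ 1\<bar> + sqrt (3 * pressure U $ 1 $ 1 / rho U)"

definition alpha2 :: "state \<Rightarrow> real" where
  "alpha2 U = \<bar>velocity U $ 2\<bar> + sqrt (3 * pressure U $ 2 $ 2 / rho U)"

definition delta1 :: "state \<Rightarrow> real" where
  "delta1 U = max (sqrt (rho U / pressure U $ 1 $ 1))
                  (sqrt (rho U * pressure U $ 2 $ 2 / det (pressure U)))"

definition delta2 :: "state \<Rightarrow> real" where
  "delta2 U = max (sqrt (rho U / pressure U $ 2 $ 2))
                  (sqrt (rho U * pressure U $ 1 $ 1 / det (pressure U)))"

definition S1 :: "state \<Rightarrow> state" where
  "S1 U = vector [0, rho U, 0, mom U $ 1, mom U $ 2 / 2, 0]"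

definition S2 :: "state \<Rightarrow> state" where
  "S2 U = vector [0, 0, rho U, 0, mom U $ 1 / 2, mom U $ 2]"

text \<open>The positivity property of the HLLC flux in the direction whose signal speed is \<open>a\<close>.
  It is the only information on the flux that is used.\<close>

definition flux_preserves_admissible ::
    "(state \<Rightarrow> state \<Rightarrow> state) \<Rightarrow> (state \<Rightarrow> real) \<Rightarrow> bool" where
  "flux_preserves_admissible F a \<longleftrightarrow>
     (\<forall>UL\<in>admissible. \<forall>UM\<in>admissible. \<forall>UR\<in>admissible. \<forall>r>0.
        r * (MAX U\<in>{UL, UM, UR}. a U) \<le> 1/2 \<longrightarrow>
        UM - r *\<^sub>R (F UM UR - F UL UM) \<in> admissible)"


section \<open>Mesh, quadrature and feasible decomposition\<close>

text \<open>The cell with index \<open>(i, l)\<close> has centre \<open>(orig_x + i dx, orig_y + l dy)\<close>. The set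
  \<open>cells\<close> holds the indices of the cells of the mesh (any set of lattice indices, in particular a
  rectangle); \<open>ext_cells\<close> below adds the ghost cells.\<close>

record disc =
  orig_x :: real
  orig_y :: real
  dx :: real
  dy :: real
  cells :: "(int \<times> int) set"
  nq :: nat                                       \<comment> \<open>number \<open>N\<close> of Gauss nodes\<close>
  node :: "nat \<Rightarrow> real"                           \<comment> \<open>Gauss nodes on \<open>[-1/2, 1/2]\<close>\<close>
  wt :: "nat \<Rightarrow> real"                             \<comment> \<open>Gauss weights\<close>
  om1m :: real                                    \<comment> \<open>weights of the feasible decomposition\<close>
  om1p :: real
  om2m :: real
  om2p :: real
  ns :: nat                                       \<comment> \<open>number \<open>S\<close> of interior points\<close>
  omt :: "nat \<Rightarrow> real"
  pt :: "int \<times> int \<Rightarrow> nat \<Rightarrow> real \<times> real"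

definition ext_cells :: "disc \<Rightarrow> (int \<times> int) set" where
  "ext_cells D = cells D \<union>
     (\<Union>(i, l)\<in>cells D. {(i - 1, l), (i + 1, l), (i, l - 1), (i, l + 1)})"

text \<open>\<open>xface D i\<close> is the interface coordinate with index \<open>i + 1/2\<close>; hence \<open>xface D (i - 1)\<close>
  is the one with index \<open>i - 1/2\<close>. The same shift is used for all interface quantities.\<close>

definition xface :: "disc \<Rightarrow> int \<Rightarrow> real" where
  "xface D i = orig_x D + (of_int i + 1/2) * dx D"

definition yface :: "disc \<Rightarrow> int \<Rightarrow> real" where
  "yface D l = orig_y D + (of_int l + 1/2) * dy D"

definition xgauss :: "disc \<Rightarrow> int \<Rightarrow> nat \<Rightarrow> real" where
  "xgauss D i \<mu> = orig_x D + (of_int i + node D \<mu>) * dx D"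

definition ygauss :: "disc \<Rightarrow> int \<Rightarrow> nat \<Rightarrow> real" where
  "ygauss D l \<mu> = orig_y D + (of_int l + node D \<mu>) * dy D"

fun cell_box :: "disc \<Rightarrow> int \<times> int \<Rightarrow> (real \<times> real) set" where
  "cell_box D (i, l) = {xface D (i - 1)..xface D i} \<times> {yface D (l - 1)..yface D l}"

text \<open>The \<open>N\<close>-point rule with the maximal degree of exactness \<open>2 N - 1\<close>. The positivity of the
  weights and the inclusion of the nodes are consequences of this, listed for convenience.\<close>

definition gauss_rule :: "disc \<Rightarrow> bool" where
  "gauss_rule D \<longleftrightarrow>
     inj_on (node D) {1..nq D} \<and>
     (\<forall>\<mu>\<in>{1..nq D}. node D \<mu> \<in> {-1/2<..<1/2} \<and> wt D \<mu> > 0) \<and>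
     (\<Sum>\<mu>=1..nq D. wt D \<mu>) = 1 \<and>
     (\<forall>n<2 * nq D. (\<Sum>\<mu>=1..nq D. wt D \<mu> * node D \<mu> ^ n) = integral {-1/2..1/2} (\<lambda>x. x ^ n))"

text \<open>Polynomial functions of two variables of total degree at most \<open>k\<close>.\<close>

definition Pk :: "nat \<Rightarrow> (real \<Rightarrow> real \<Rightarrow> real) set" where
  "Pk k = {f. \<exists>c :: nat \<Rightarrow> nat \<Rightarrow> real.
             \<forall>x y. f x y = (\<Sum>a\<le>k. \<Sum>b\<le>k - a. c a b * x ^ a * y ^ b)}"

text \<open>A discontinuous piecewise polynomial is a family of functions indexed by the cells. Its
  value from inside a cell, in particular its one-sided limit at an interface, is the value of the
  polynomial belonging to that cell.\<close>

type_synonym 'a broken = "int \<times> int \<Rightarrow> real \<Rightarrow> real \<Rightarrow> 'a"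

definition Vh :: "disc \<Rightarrow> nat \<Rightarrow> real broken set" where
  "Vh D k = {f. \<forall>K\<in>ext_cells D. f K \<in> Pk k}"

definition Vh_state :: "disc \<Rightarrow> nat \<Rightarrow> state broken set" where
  "Vh_state D k = {U. \<forall>j. (\<lambda>K x y. U K x y $ j) \<in> Vh D k}"

definition cell_avg :: "disc \<Rightarrow> ('a::euclidean_space) broken \<Rightarrow> int \<times> int \<Rightarrow> 'a" where
  "cell_avg D f K = (1 / (dx D * dy D)) *\<^sub>R integral (cell_box D K) (\<lambda>(x, y). f K x y)"

text \<open>\<open>Minus\<close>: limit from the left or below; \<open>Plus\<close>: limit from the right or above.\<close>

datatype side = Minus | Plus

fun shift :: "side \<Rightarrow> int" where
  "shift Minus = 0" | "shift Plus = 1"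

definition trace_x :: "disc \<Rightarrow> 'a broken \<Rightarrow> side \<Rightarrow> int \<Rightarrow> int \<Rightarrow> nat \<Rightarrow> 'a" where
  "trace_x D f s i l \<mu> = f (i + shift s, l) (xface D i) (ygauss D l \<mu>)"

definition trace_y :: "disc \<Rightarrow> 'a broken \<Rightarrow> side \<Rightarrow> int \<Rightarrow> int \<Rightarrow> nat \<Rightarrow> 'a" where
  "trace_y D f s i l \<mu> = f (i, l + shift s) (xgauss D i \<mu>) (yface D l)"

definition feasible_decomposition :: "disc \<Rightarrow> nat \<Rightarrow> bool" where
  "feasible_decomposition D k \<longleftrightarrow>
     om1m D > 0 \<and> om1p D > 0 \<and> om2m D > 0 \<and> om2p D > 0 \<and> (\<forall>s\<in>{1..ns D}. omt D s > 0) \<and>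
     om1m D + om1p D + om2m D + om2p D + (\<Sum>s=1..ns D. omt D s) = 1 \<and>
     (\<forall>K\<in>ext_cells D. \<forall>s\<in>{1..ns D}. pt D K s \<in> cell_box D K) \<and>
     (\<forall>f\<in>Vh D k. \<forall>(i, l)\<in>ext_cells D.
        cell_avg D f (i, l) =
          (\<Sum>\<mu>=1..nq D. wt D \<mu> *
             (om1m D * trace_x D f Minus i l \<mu> + om1p D * trace_x D f Plus (i - 1) l \<mu>
              + om2m D * trace_y D f Minus i l \<mu> + om2p D * trace_y D f Plus i (l - 1) \<mu>))
          + (\<Sum>s=1..ns D. omt D s * f (i, l) (fst (pt D (i, l) s)) (snd (pt D (i, l) s))))"

fun point_set :: "disc \<Rightarrow> int \<times> int \<Rightarrow> (real \<times> real) set" where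
  "point_set D (i, l) =
     (\<Union>\<mu>\<in>{1..nq D}.
        {(xface D i, ygauss D l \<mu>), (xface D (i - 1), ygauss D l \<mu>),
         (xgauss D i \<mu>, yface D l), (xgauss D i \<mu>, yface D (l - 1))})
     \<union> (\<lambda>s. pt D (i, l) s) ` {1..ns D}
     \<union> {(xgauss D i \<mu>1, ygauss D l \<mu>2) | \<mu>1 \<mu>2. \<mu>1 \<in> {1..nq D} \<and> \<mu>2 \<in> {1..nq D}}"


section \<open>Projected equilibrium and modified states\<close>

record equil =
  rho_e :: "real broken"
  p11_e :: "real broken"
  p22_e :: "real broken"
  C0 :: real

definition p_e :: "equil \<Rightarrow> (real^2^2) broken" where
  "p_e Q K x y = mat2 (p11_e Q K x y) (C0 Q) (C0 Q) (p22_e Q K x y)"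

definition p11_star :: "disc \<Rightarrow> equil \<Rightarrow> int \<Rightarrow> int \<Rightarrow> nat \<Rightarrow> real" where
  "p11_star D Q i l \<mu> = max (trace_x D (p11_e Q) Minus i l \<mu>) (trace_x D (p11_e Q) Plus i l \<mu>)"

definition p22_star :: "disc \<Rightarrow> equil \<Rightarrow> int \<Rightarrow> int \<Rightarrow> nat \<Rightarrow> real" where
  "p22_star D Q i l \<mu> = max (trace_y D (p22_e Q) Minus i l \<mu>) (trace_y D (p22_e Q) Plus i l \<mu>)"

definition T_x :: "disc \<Rightarrow> equil \<Rightarrow> side \<Rightarrow> int \<Rightarrow> int \<Rightarrow> nat \<Rightarrow> real^2^2" where
  "T_x D Q s i l \<mu> =
     (let p = trace_x D (p_e Q) s i l \<mu>;
          p' = mat2 (p11_star D Q i l \<mu>) (C0 Q) (C0 Q) (p $ 2 $ 2);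
          t1 = sqrt (det p' / det p);
          t2 = C0 Q * (1 - t1) / (p $ 2 $ 2)
      in mat2 t1 t2 0 1)"

definition T_y :: "disc \<Rightarrow> equil \<Rightarrow> side \<Rightarrow> int \<Rightarrow> int \<Rightarrow> nat \<Rightarrow> real^2^2" where
  "T_y D Q s i l \<mu> =
     (let p = trace_y D (p_e Q) s i l \<mu>;
          p' = mat2 (p $ 1 $ 1) (C0 Q) (C0 Q) (p22_star D Q i l \<mu>);
          t3 = sqrt (det p' / det p);
          t4 = C0 Q * (1 - t3) / (p $ 1 $ 1)
      in mat2 1 0 t4 t3)"

definition modify :: "real^2^2 \<Rightarrow> state \<Rightarrow> state" where
  "modify T U = mk_state (rho U) (T *v mom U) (T ** energy U ** transpose T)"

definition Uhat_x :: "disc \<Rightarrow> equil \<Rightarrow> state broken \<Rightarrow> side \<Rightarrow> int \<Rightarrow> int \<Rightarrow> nat \<Rightarrow> state" where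
  "Uhat_x D Q U s i l \<mu> = modify (T_x D Q s i l \<mu>) (trace_x D U s i l \<mu>)"

definition Uhat_y :: "disc \<Rightarrow> equil \<Rightarrow> state broken \<Rightarrow> side \<Rightarrow> int \<Rightarrow> int \<Rightarrow> nat \<Rightarrow> state" where
  "Uhat_y D Q U s i l \<mu> = modify (T_y D Q s i l \<mu>) (trace_y D U s i l \<mu>)"


section \<open>The quantity xi-star\<close>

text \<open>The unique symmetric positive-definite square root of a symmetric positive-definite matrix.\<close>

definition mat_sqrt :: "real^'n^'n \<Rightarrow> real^'n^'n" where
  "mat_sqrt A = (THE B. transpose B = B \<and> pos_def B \<and> B ** B = A)"

text \<open>Spectral norm: the operator norm for the Euclidean norm.\<close>

definition norm2 :: "real^'n^'m \<Rightarrow> real" where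
  "norm2 A = onorm (\<lambda>v. A *v v)"

definition f1 :: "real^2^2 \<Rightarrow> state \<Rightarrow> real" where
  "f1 T U = (norm2 (matrix_inv (mat_sqrt (pressure U)) ** T ** mat_sqrt (pressure U)))\<^sup>2"

definition theta1 :: "real \<Rightarrow> real \<Rightarrow> real" where
  "theta1 a b = (sqrt ((a + b - 1)\<^sup>2 + 4 * b) - (a + b - 1)) / 2"

definition xi_star :: "real^2^2 \<Rightarrow> state \<Rightarrow> real \<Rightarrow> real \<Rightarrow> real" where
  "xi_star T U f2 f3 = (1 - max (theta1 (f1 T U) f2) (theta1 (f1 T U) f3)) / f1 T U"

definition xi_star_x :: "real^2^2 \<Rightarrow> state \<Rightarrow> real" where
  "xi_star_x T U =
     (let p = pressure U; m = mom U;
          q = ((1 - T $ 1 $ 1) * m $ 1 - T $ 1 $ 2 * m $ 2)\<^sup>2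
      in xi_star T U (q / (rho U * p $ 1 $ 1)) (q * p $ 2 $ 2 / (rho U * det p)))"

definition xi_star_y :: "real^2^2 \<Rightarrow> state \<Rightarrow> real" where
  "xi_star_y T U =
     (let p = pressure U; m = mom U;
          q = ((1 - T $ 2 $ 2) * m $ 2 - T $ 2 $ 1 * m $ 1)\<^sup>2
      in xi_star T U (q / (rho U * p $ 2 $ 2)) (q * p $ 1 $ 1 / (rho U * det p)))"


section \<open>The cell-average update and the CFL condition\<close>

fun alpha11 :: "disc \<Rightarrow> equil \<Rightarrow> int \<times> int \<Rightarrow> real" where
  "alpha11 D Q (i, l) =
     (\<Sum>\<mu>=1..nq D. wt D \<mu> *
        (p11_star D Q i l \<mu> - p11_star D Q (i - 1) l \<mu>
         - trace_x D (p11_e Q) Minus i l \<mu> + trace_x D (p11_e Q) Plus (i - 1) l \<mu>))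
     / (dx D * cell_avg D (rho_e Q) (i, l))"

fun alpha22 :: "disc \<Rightarrow> equil \<Rightarrow> int \<times> int \<Rightarrow> real" where
  "alpha22 D Q (i, l) =
     (\<Sum>\<mu>=1..nq D. wt D \<mu> *
        (p22_star D Q i l \<mu> - p22_star D Q i (l - 1) \<mu>
         - trace_y D (p22_e Q) Minus i l \<mu> + trace_y D (p22_e Q) Plus i (l - 1) \<mu>))
     / (dy D * cell_avg D (rho_e Q) (i, l))"

definition ratio_x :: "equil \<Rightarrow> real broken" where
  "ratio_x Q K x y = deriv (\<lambda>x'. p11_e Q K x' y) x / rho_e Q K x y"

definition ratio_y :: "equil \<Rightarrow> real broken" where
  "ratio_y Q K x y = deriv (\<lambda>y'. p22_e Q K x y') y / rho_e Q K x y"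

definition at_gauss :: "disc \<Rightarrow> 'a broken \<Rightarrow> int \<times> int \<Rightarrow> nat \<Rightarrow> nat \<Rightarrow> 'a" where
  "at_gauss D f K \<mu>1 \<mu>2 = f K (xgauss D (fst K) \<mu>1) (ygauss D (snd K) \<mu>2)"

definition source_x :: "disc \<Rightarrow> equil \<Rightarrow> state broken \<Rightarrow> int \<times> int \<Rightarrow> state" where
  "source_x D Q U K =
     (\<Sum>\<mu>1=1..nq D. \<Sum>\<mu>2=1..nq D. (wt D \<mu>1 * wt D \<mu>2) *\<^sub>R
        at_gauss D (\<lambda>K x y. ratio_x Q K x y *\<^sub>R S1 (U K x y)) K \<mu>1 \<mu>2)
     + alpha11 D Q K *\<^sub>R S1 (cell_avg D U K)"

definition source_y :: "disc \<Rightarrow> equil \<Rightarrow> state broken \<Rightarrow> int \<times> int \<Rightarrow> state" where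
  "source_y D Q U K =
     (\<Sum>\<mu>1=1..nq D. \<Sum>\<mu>2=1..nq D. (wt D \<mu>1 * wt D \<mu>2) *\<^sub>R
        at_gauss D (\<lambda>K x y. ratio_y Q K x y *\<^sub>R S2 (U K x y)) K \<mu>1 \<mu>2)
     + alpha22 D Q K *\<^sub>R S2 (cell_avg D U K)"

definition face_flux_x ::
    "disc \<Rightarrow> equil \<Rightarrow> (state \<Rightarrow> state \<Rightarrow> state) \<Rightarrow> state broken \<Rightarrow> int \<Rightarrow> int \<Rightarrow> nat \<Rightarrow> state" where
  "face_flux_x D Q F U i l \<mu> = F (Uhat_x D Q U Minus i l \<mu>) (Uhat_x D Q U Plus i l \<mu>)"

definition face_flux_y ::
    "disc \<Rightarrow> equil \<Rightarrow> (state \<Rightarrow> state \<Rightarrow> state) \<Rightarrow> state broken \<Rightarrow> int \<Rightarrow> int \<Rightarrow> nat \<Rightarrow> state" where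
  "face_flux_y D Q G U i l \<mu> = G (Uhat_y D Q U Minus i l \<mu>) (Uhat_y D Q U Plus i l \<mu>)"

fun new_avg :: "disc \<Rightarrow> equil \<Rightarrow> (state \<Rightarrow> state \<Rightarrow> state) \<Rightarrow> (state \<Rightarrow> state \<Rightarrow> state) \<Rightarrow> real
    \<Rightarrow> state broken \<Rightarrow> int \<times> int \<Rightarrow> state" where
  "new_avg D Q F G dt U (i, l) =
     cell_avg D U (i, l)
     - (dt / dx D) *\<^sub>R (\<Sum>\<mu>=1..nq D. wt D \<mu> *\<^sub>R
         (face_flux_x D Q F U i l \<mu> - face_flux_x D Q F U (i - 1) l \<mu>))
     - (dt / dy D) *\<^sub>R (\<Sum>\<mu>=1..nq D. wt D \<mu> *\<^sub>R
         (face_flux_y D Q G U i l \<mu> - face_flux_y D Q G U i (l - 1) \<mu>))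
     + dt *\<^sub>R source_x D Q U (i, l) + dt *\<^sub>R source_y D Q U (i, l)"

text \<open>In the names below, \<open>R\<close>, \<open>L\<close>, \<open>T\<close>, \<open>B\<close> denote the right, left, top and bottom edge of the
  cell \<open>(i, l)\<close>; the state in the argument of xi-star is the trace from inside that cell.\<close>

definition eta1_R :: "disc \<Rightarrow> equil \<Rightarrow> state broken \<Rightarrow> int \<Rightarrow> int \<Rightarrow> nat \<Rightarrow> real" where
  "eta1_R D Q U i l \<mu> =
     2 / xi_star_x (T_x D Q Minus i l \<mu>) (trace_x D U Minus i l \<mu>) *
     (MAX V\<in>{Uhat_x D Q U Minus i l \<mu>, Uhat_x D Q U Plus i l \<mu>, Uhat_x D Q U Plus (i - 1) l \<mu>}.
        alpha1 V)"

definition eta1_L :: "disc \<Rightarrow> equil \<Rightarrow> state broken \<Rightarrow> int \<Rightarrow> int \<Rightarrow> nat \<Rightarrow> real" where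
  "eta1_L D Q U i l \<mu> =
     2 / xi_star_x (T_x D Q Plus (i - 1) l \<mu>) (trace_x D U Plus (i - 1) l \<mu>) *
     (MAX V\<in>{Uhat_x D Q U Minus (i - 1) l \<mu>, Uhat_x D Q U Plus (i - 1) l \<mu>, Uhat_x D Q U Minus i l \<mu>}.
        alpha1 V)"

definition eta2_T :: "disc \<Rightarrow> equil \<Rightarrow> state broken \<Rightarrow> int \<Rightarrow> int \<Rightarrow> nat \<Rightarrow> real" where
  "eta2_T D Q U i l \<mu> =
     2 / xi_star_y (T_y D Q Minus i l \<mu>) (trace_y D U Minus i l \<mu>) *
     (MAX V\<in>{Uhat_y D Q U Minus i l \<mu>, Uhat_y D Q U Plus i l \<mu>, Uhat_y D Q U Plus i (l - 1) \<mu>}.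
        alpha2 V)"

definition eta2_B :: "disc \<Rightarrow> equil \<Rightarrow> state broken \<Rightarrow> int \<Rightarrow> int \<Rightarrow> nat \<Rightarrow> real" where
  "eta2_B D Q U i l \<mu> =
     2 / xi_star_y (T_y D Q Plus i (l - 1) \<mu>) (trace_y D U Plus i (l - 1) \<mu>) *
     (MAX V\<in>{Uhat_y D Q U Minus i (l - 1) \<mu>, Uhat_y D Q U Plus i (l - 1) \<mu>, Uhat_y D Q U Minus i l \<mu>}.
        alpha2 V)"

definition beta11 :: "disc \<Rightarrow> equil \<Rightarrow> state broken \<Rightarrow> int \<times> int \<Rightarrow> real" where
  "beta11 D Q U K =
     (MAX (\<mu>1, \<mu>2)\<in>{1..nq D} \<times> {1..nq D}.
        \<bar>at_gauss D (\<lambda>K x y. ratio_x Q K x y * delta1 (U K x y)) K \<mu>1 \<mu>2\<bar>)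
     + \<bar>alpha11 D Q K * delta1 (cell_avg D U K)\<bar>"

definition beta22 :: "disc \<Rightarrow> equil \<Rightarrow> state broken \<Rightarrow> int \<times> int \<Rightarrow> real" where
  "beta22 D Q U K =
     (MAX (\<mu>1, \<mu>2)\<in>{1..nq D} \<times> {1..nq D}.
        \<bar>at_gauss D (\<lambda>K x y. ratio_y Q K x y * delta2 (U K x y)) K \<mu>1 \<mu>2\<bar>)
     + \<bar>alpha22 D Q K * delta2 (cell_avg D U K)\<bar>"

fun cfl_condition :: "disc \<Rightarrow> equil \<Rightarrow> real \<Rightarrow> state broken \<Rightarrow> int \<times> int \<Rightarrow> bool" where
  "cfl_condition D Q dt U (i, l) \<longleftrightarrow>
     dt * (Max (\<Union>\<mu>\<in>{1..nq D}.
              {eta1_R D Q U i l \<mu> / (om1m D * dx D), eta1_L D Q U i l \<mu> / (om1p D * dx D),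
               eta2_T D Q U i l \<mu> / (om2m D * dy D), eta2_B D Q U i l \<mu> / (om2p D * dy D)})
           + beta11 D Q U (i, l) + beta22 D Q U (i, l)) \<le> 1"

end

theory Submission
  imports Defs
begin

text \<open>A state is admissible iff the quadratic form
  \<open>\<rho> w\<^sup>2 + 2 w (m \<bullet> z) + 2 (z \<bullet> E z)\<close> in \<open>(w, z)\<close>, which is linear in the state, is positive
  definite; it equals \<open>\<rho> (w + u \<bullet> z)\<^sup>2 + z \<bullet> p z\<close>. Everything is checked on this form.
  The source \<open>S1 U\<close> is dominated by \<open>delta1 U\<close> times \<open>U\<close>, and \<open>xi_star\<close> times the modified state
  is dominated by \<open>U\<close>. Let \<open>\<theta>\<close> be the flux part of the CFL number. The share \<open>\<theta>\<close> of the cell average,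
  written by the feasible decomposition, absorbs the flux differences, after inserting in every
  direction the flux between the two inner traces of the cell. The remaining share, written by
  tensor Gauss quadrature, absorbs the sources.\<close>

section \<open>The quadratic form of a state\<close>

lemma vector_6:
  fixes a b c d e f :: "'a::zero"
  shows "(vector [a, b, c, d, e, f] :: 'a^6) $ 1 = a" "(vector [a, b, c, d, e, f] :: 'a^6) $ 2 = b"
    "(vector [a, b, c, d, e, f] :: 'a^6) $ 3 = c" "(vector [a, b, c, d, e, f] :: 'a^6) $ 4 = d"
    "(vector [a, b, c, d, e, f] :: 'a^6) $ 5 = e" "(vector [a, b, c, d, e, f] :: 'a^6) $ 6 = f"
  unfolding vector_def by simp_all

lemma mat2_nth [simp]:
  "mat2 a b c d $ 1 $ 1 = a" "mat2 a b c d $ 1 $ 2 = b"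
  "mat2 a b c d $ 2 $ 1 = c" "mat2 a b c d $ 2 $ 2 = d"
  by (simp_all add: mat2_def)

text \<open>The quadratic form of the symmetric 3x3 block matrix with diagonal blocks
  \<open>rho U\<close> and \<open>2 * energy U\<close> and off-diagonal block \<open>mom U\<close>.
  The pressure is the Schur complement of \<open>rho U\<close> in it.\<close>

definition qform :: "state \<Rightarrow> real \<Rightarrow> real^2 \<Rightarrow> real" where
  "qform U w z = rho U * w\<^sup>2 + 2 * w * (mom U \<bullet> z) + 2 * (z \<bullet> (energy U *v z))"

lemma inner_real2: "(x :: real^2) \<bullet> y = x $ 1 * y $ 1 + x $ 2 * y $ 2"
  by (simp add: inner_vec_def sum_2)

lemma quad_real2:
  "z \<bullet> ((A :: real^2^2) *v z) =
     A $ 1 $ 1 * (z $ 1)\<^sup>2 + (A $ 1 $ 2 + A $ 2 $ 1) * z $ 1 * z $ 2 + A $ 2 $ 2 * (z $ 2)\<^sup>2"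
  by (simp add: inner_real2 matrix_vector_mult_def sum_2 power2_eq_square algebra_simps)

lemma qform_expand:
  "qform U w z = U $ 1 * w\<^sup>2 + 2 * w * (U $ 2 * z $ 1 + U $ 3 * z $ 2)
     + 2 * (U $ 4 * (z $ 1)\<^sup>2 + 2 * U $ 5 * z $ 1 * z $ 2 + U $ 6 * (z $ 2)\<^sup>2)"
  unfolding qform_def quad_real2 unfolding inner_real2
  by (simp add: rho_def mom_def energy_def algebra_simps)

lemma qform_linear [simp]:
  "qform (U + V) w z = qform U w z + qform V w z"
  "qform (U - V) w z = qform U w z - qform V w z"
  "qform (c *\<^sub>R U) w z = c * qform U w z"
  by (simp_all add: qform_expand algebra_simps)

lemma qform_sum [simp]: "qform (\<Sum>i\<in>I. f i) w z = (\<Sum>i\<in>I. qform (f i) w z)"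
proof (induction I rule: infinite_finite_induct)
\<comment> \<open>The infinite and empty index sets both reduce to
  \<open>qform 0 w z = 0\<close>.\<close>
qed (simp_all add: qform_expand[of 0])

lemma qform_complete_square:
  assumes "rho U \<noteq> 0"
  shows "qform U w z = rho U * (w + velocity U \<bullet> z)\<^sup>2 + z \<bullet> (pressure U *v z)"
  using assms unfolding qform_def quad_real2 unfolding inner_real2
  by (simp add: velocity_def pressure_def power2_eq_square field_simps)

text \<open>The Schur complement criterion for positive definiteness. It turns the nonlinear
  membership in \<open>admissible\<close> into inequalities linear in the state, so that estimates
  can be made for one fixed \<open>(w, z)\<close> at a time.\<close>

lemma admissible_iff_qform:
  "U \<in> admissible \<longleftrightarrow> (\<forall>w z. (w, z) \<noteq> 0 \<longrightarrow> 0 < qform U w z)"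
proof
  assume U: "U \<in> admissible"
  then have r: "rho U > 0" and p: "\<And>z. z \<noteq> 0 \<Longrightarrow> z \<bullet> (pressure U *v z) > 0"
    by (auto simp: admissible_def pos_def_def)
  show "\<forall>w z. (w, z) \<noteq> 0 \<longrightarrow> 0 < qform U w z"
  proof (intro allI impI)
    fix w :: real and z :: "real^2" assume wz: "(w, z) \<noteq> 0"
    show "0 < qform U w z"
    proof (cases "z = 0")
      case True
      then show ?thesis using wz r by (simp add: qform_def zero_prod_def)
    next
      case False
      then show ?thesis using r p[of z]
        by (simp add: qform_complete_square add_nonneg_pos)
    qed
  qed
next
  assume *: "\<forall>w z. (w, z) \<noteq> 0 \<longrightarrow> 0 < qform U w z"
  have r: "rho U > 0" using *[rule_format, of 1 0] by (simp add: qform_def zero_prod_def)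
  \<comment> \<open>The choice w = - u z makes the completed square vanish and leaves only the
    pressure term.\<close>
  moreover have "z \<bullet> (pressure U *v z) > 0" if "z \<noteq> 0" for z
    using *[rule_format, of "- (velocity U \<bullet> z)" z] that r
    by (simp add: qform_complete_square zero_prod_def)
  ultimately show "U \<in> admissible" by (simp add: admissible_def pos_def_def)
qed

lemma qform_nonneg: "U \<in> admissible \<Longrightarrow> 0 \<le> qform U w z"
  by (cases "(w, z) = 0")
     (auto simp: admissible_iff_qform zero_prod_def qform_def intro: less_imp_le)

section \<open>Positive definite 2x2 matrices\<close>

lemma pos_def_2D:
  assumes "pos_def (A :: real^2^2)" "A $ 1 $ 2 = A $ 2 $ 1"
  shows "A $ 1 $ 1 > 0" "A $ 2 $ 2 > 0" "det A > 0"
proof -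
  have q: "z \<noteq> 0 \<Longrightarrow> z \<bullet> (A *v z) > 0" for z using assms(1) by (simp add: pos_def_def)
  show a: "A $ 1 $ 1 > 0"
    using q[of "vector [1, 0]"] by (simp add: quad_real2 vec_eq_iff forall_2)
  show "A $ 2 $ 2 > 0"
    using q[of "vector [0, 1]"] by (simp add: quad_real2 vec_eq_iff forall_2)
  \<comment> \<open>This vector is orthogonal to the first row of \<open>A\<close>, so the form
    there collapses to the first diagonal entry times the determinant.\<close>
  have "0 < A $ 1 $ 1 * det A"
    using q[of "vector [A $ 1 $ 2, - A $ 1 $ 1]"] a assms(2)
    by (simp add: quad_real2 vec_eq_iff forall_2 det_2 power2_eq_square algebra_simps)
  then show "det A > 0" using a by (simp add: zero_less_mult_iff)
qed

lemma pos_def_2I: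
  fixes A :: "real^2^2"
  assumes "A $ 1 $ 1 > 0" "det A > 0" "A $ 1 $ 2 = A $ 2 $ 1"
  shows "pos_def A"
  unfolding pos_def_def
proof (intro allI impI)
  fix z :: "real^2" assume z: "z \<noteq> 0"
  have eq: "A $ 1 $ 1 * (z \<bullet> (A *v z)) = (A $ 1 $ 1 * z $ 1 + A $ 1 $ 2 * z $ 2)\<^sup>2 + det A * (z $ 2)\<^sup>2"
    using assms(3) by (simp add: quad_real2 det_2 power2_eq_square algebra_simps)
  have "0 < A $ 1 $ 1 * (z \<bullet> (A *v z))"
  proof (cases "z $ 2 = 0")
    case True
    then have "z $ 1 \<noteq> 0" using z by (auto simp: vec_eq_iff forall_2)
    then show ?thesis using True assms(1) unfolding eq by simp
  next
    case False
    then show ?thesis using assms(2) unfolding eq by (simp add: add_nonneg_pos)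
  qed
  then show "z \<bullet> (A *v z) > 0" using assms(1) by (simp add: zero_less_mult_iff)
qed

lemma pressure_sym: "pressure U $ 1 $ 2 = pressure U $ 2 $ 1"
  by (simp add: pressure_def energy_def mult.commute)

lemma admissibleD:
  assumes "U \<in> admissible"
  shows "rho U > 0" "pos_def (pressure U)" "pressure U $ 1 $ 1 > 0" "pressure U $ 2 $ 2 > 0"
    "det (pressure U) > 0"
  using assms pos_def_2D[of "pressure U"] pressure_sym by (auto simp: admissible_def)

text \<open>Completing the square in the other variable leaves exactly the determinant term. Divided
  by \<open>det A\<close>, the constants are the diagonal entries of the inverse of
  \<open>A\<close>.\<close>

lemma quad_ge_component:
  fixes A :: "real^2^2"
  assumes "pos_def A" "A $ 1 $ 2 = A $ 2 $ 1"
  shows "det A * (z $ 1)\<^sup>2 \<le> A $ 2 $ 2 * (z \<bullet> (A *v z))"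
    and "det A * (z $ 2)\<^sup>2 \<le> A $ 1 $ 1 * (z \<bullet> (A *v z))"
proof -
  have "A $ 2 $ 2 * (z \<bullet> (A *v z)) = (A $ 2 $ 2 * z $ 2 + A $ 1 $ 2 * z $ 1)\<^sup>2 + det A * (z $ 1)\<^sup>2"
    using assms(2) by (simp add: quad_real2 det_2 power2_eq_square algebra_simps)
  then show "det A * (z $ 1)\<^sup>2 \<le> A $ 2 $ 2 * (z \<bullet> (A *v z))" by simp
  have "A $ 1 $ 1 * (z \<bullet> (A *v z)) = (A $ 1 $ 1 * z $ 1 + A $ 1 $ 2 * z $ 2)\<^sup>2 + det A * (z $ 2)\<^sup>2"
    using assms(2) by (simp add: quad_real2 det_2 power2_eq_square algebra_simps)
  then show "det A * (z $ 2)\<^sup>2 \<le> A $ 1 $ 1 * (z \<bullet> (A *v z))" by simp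
qed

section \<open>Domination of the source vectors by the state\<close>

lemma qform_S1: "rho U \<noteq> 0 \<Longrightarrow> qform (S1 U) w z = 2 * rho U * z $ 1 * (w + velocity U \<bullet> z)"
  by (simp add: qform_expand S1_def vector_6 velocity_def inner_real2 field_simps power2_eq_square)

lemma qform_S2: "rho U \<noteq> 0 \<Longrightarrow> qform (S2 U) w z = 2 * rho U * z $ 2 * (w + velocity U \<bullet> z)"
  by (simp add: qform_expand S2_def vector_6 velocity_def inner_real2 field_simps power2_eq_square)

text \<open>Weighted arithmetic-geometric mean inequality, with the weight s = sqrt (r P / d)
  balancing a against x. In the application a is w + u z, x is a component of z and X is the
  pressure term, so the right-hand bracket is \<open>qform\<close>.\<close>

lemma abs_cross_term_le:
  fixes r a x d P X \<delta> :: real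
  assumes "r > 0" "P > 0" "d > 0" "d * x\<^sup>2 \<le> P * X" "sqrt (r * P / d) \<le> \<delta>"
  shows "\<bar>2 * r * x * a\<bar> \<le> \<delta> * (r * a\<^sup>2 + X)"
proof -
  define s where "s = sqrt (r * P / d)"
  have s: "s > 0" "s\<^sup>2 = r * P / d" using assms by (simp_all add: s_def)
  have X: "r * x\<^sup>2 \<le> s\<^sup>2 * X"
    using mult_left_mono[OF assms(4), of r] assms by (simp add: s field_simps)
  have "0 \<le> r * (s * \<bar>a\<bar> - \<bar>x\<bar>)\<^sup>2" using assms by simp
  then have "s * (2 * r * \<bar>x\<bar> * \<bar>a\<bar>) \<le> s\<^sup>2 * r * a\<^sup>2 + r * x\<^sup>2"
    by (simp add: power2_eq_square algebra_simps)
  also have "\<dots> \<le> s * (s * (r * a\<^sup>2 + X))" using X by (simp add: power2_eq_square algebra_simps)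
  finally have 1: "2 * r * \<bar>x\<bar> * \<bar>a\<bar> \<le> s * (r * a\<^sup>2 + X)" using s by simp
  \<comment> \<open>The sign of \<open>X\<close> comes from r x^2 \<le> s^2 X; it permits replacing
    s by the larger \<delta>.\<close>
  have "0 \<le> r * a\<^sup>2 + X"
    using assms X s by (smt (verit) mult_nonneg_nonneg mult_le_cancel_left_pos zero_le_power2 mult_pos_neg zero_less_power)
  then have "s * (r * a\<^sup>2 + X) \<le> \<delta> * (r * a\<^sup>2 + X)"
    using assms(5) by (intro mult_right_mono) (simp_all add: s_def)
  with 1 show ?thesis using assms(1) by (simp add: abs_mult)
qed

lemma qform_S1_le:
  assumes "U \<in> admissible"
  shows "\<bar>qform (S1 U) w z\<bar> \<le> delta1 U * qform U w z"
proof -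
  note U = admissibleD[OF assms]
  show ?thesis
    using U abs_cross_term_le[OF U(1) U(4) U(5) quad_ge_component(1)[OF U(2) pressure_sym], of "delta1 U"]
    by (simp add: qform_S1 qform_complete_square delta1_def)
qed

lemma qform_S2_le:
  assumes "U \<in> admissible"
  shows "\<bar>qform (S2 U) w z\<bar> \<le> delta2 U * qform U w z"
proof -
  note U = admissibleD[OF assms]
  show ?thesis
    using U abs_cross_term_le[OF U(1) U(3) U(5) quad_ge_component(2)[OF U(2) pressure_sym], of "delta2 U"]
    by (simp add: qform_S2 qform_complete_square delta2_def)
qed

text \<open>Modifying a state is a congruence of its 3x3 matrix by the block diagonal matrix of 1
  and \<open>T\<close>, hence a pullback of the form. An invertible \<open>T\<close> therefore
  preserves positive definiteness.\<close>

lemma qform_modify: "qform (modify T U) w z = qform U w (transpose T *v z)"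
  by (simp add: qform_expand modify_def mk_state_def vector_6 rho_def mom_def energy_def
      matrix_matrix_mult_def matrix_vector_mult_def transpose_def sum_2 power2_eq_square algebra_simps)

lemma modify_admissible:
  assumes "U \<in> admissible" "det T \<noteq> 0"
  shows "modify T U \<in> admissible"
  unfolding admissible_iff_qform
proof (intro allI impI)
  fix w :: real and z :: "real^2" assume wz: "(w, z) \<noteq> 0"
  have "transpose T *v z \<noteq> 0" if "z \<noteq> 0"
    using that assms(2)
    by (metis det_transpose invertible_det_nz matrix_left_invertible_ker invertible_left_inverse)
  then have "(w, transpose T *v z) \<noteq> 0" using wz by (auto simp: zero_prod_def)
  then show "0 < qform (modify T U) w z"
    using assms(1) by (simp add: qform_modify admissible_iff_qform)
qed

section \<open>Square roots of matrices and the quantity xi-star\<close>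

text \<open>By Cayley--Hamilton \<open>B\<^sup>2 = tr B \<cdot> B - det B\<close>, which determines a positive definite root \<open>B\<close> of \<open>A\<close>
  from \<open>det B = sqrt (det A)\<close> and \<open>(tr B)\<^sup>2 = tr A + 2 det B\<close>.\<close>

definition sqrt_mat2 :: "real^2^2 \<Rightarrow> real^2^2" where
  "sqrt_mat2 A = (1 / sqrt (A $ 1 $ 1 + A $ 2 $ 2 + 2 * sqrt (det A))) *\<^sub>R (A + mat (sqrt (det A)))"

lemma mat2_eq_iff:
  "(A :: real^2^2) = B \<longleftrightarrow>
     A $ 1 $ 1 = B $ 1 $ 1 \<and> A $ 1 $ 2 = B $ 1 $ 2 \<and> A $ 2 $ 1 = B $ 2 $ 1 \<and> A $ 2 $ 2 = B $ 2 $ 2"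
  by (auto simp: vec_eq_iff forall_2)

lemma sqrt2_unique:
  fixes A B :: "real^2^2"
  assumes sym: "transpose B = B" and pd: "pos_def B" and sq: "B ** B = A"
  shows "B = sqrt_mat2 A"
proof -
  have s: "B $ 1 $ 2 = B $ 2 $ 1" using arg_cong[OF sym, of "\<lambda>M. M $ 2 $ 1"] by (simp add: transpose_def)
  note B = pos_def_2D[OF pd s]
  have "det A = (det B)\<^sup>2" unfolding sq[symmetric] by (simp add: det_mul power2_eq_square)
  then have d: "sqrt (det A) = det B" using B by simp
  have "A $ 1 $ 1 + A $ 2 $ 2 + 2 * det B = (B $ 1 $ 1 + B $ 2 $ 2)\<^sup>2"
    unfolding sq[symmetric]
    by (simp add: matrix_matrix_mult_def sum_2 det_2 power2_eq_square algebra_simps)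
  then have t: "sqrt (A $ 1 $ 1 + A $ 2 $ 2 + 2 * sqrt (det A)) = B $ 1 $ 1 + B $ 2 $ 2"
    using B d by simp
  have "A + mat (det B) = (B $ 1 $ 1 + B $ 2 $ 2) *\<^sub>R B"
    unfolding sq[symmetric] mat2_eq_iff
    by (simp add: matrix_matrix_mult_def sum_2 det_2 mat_def power2_eq_square algebra_simps)
  then show ?thesis using B unfolding sqrt_mat2_def t unfolding d by simp
qed

lemma sqrt_mat2:
  fixes A :: "real^2^2"
  assumes pd: "pos_def A" and s: "A $ 1 $ 2 = A $ 2 $ 1"
  shows "transpose (sqrt_mat2 A) = sqrt_mat2 A" "pos_def (sqrt_mat2 A)" "sqrt_mat2 A ** sqrt_mat2 A = A"
proof -
  note A = pos_def_2D[OF pd s]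
  define d where "d = sqrt (det A)"
  define t where "t = sqrt (A $ 1 $ 1 + A $ 2 $ 2 + 2 * d)"
  have d: "d > 0" "d * d = A $ 1 $ 1 * A $ 2 $ 2 - A $ 1 $ 2 * A $ 2 $ 1"
    using A by (simp_all add: d_def det_2)
  have t: "t > 0" "t * t = A $ 1 $ 1 + A $ 2 $ 2 + 2 * d" using A d by (simp_all add: t_def)
  have e: "sqrt_mat2 A = (1 / t) *\<^sub>R (A + mat d)" by (simp add: sqrt_mat2_def t_def d_def)
  show "transpose (sqrt_mat2 A) = sqrt_mat2 A"
    using s unfolding e mat2_eq_iff by (simp add: transpose_def mat_def)
  have scaled: "(c *\<^sub>R M) ** (c *\<^sub>R M) = (c * c) *\<^sub>R (M ** M)" for c and M :: "real^2^2"
    unfolding mat2_eq_iff by (simp add: matrix_matrix_mult_def sum_2 algebra_simps)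
  have "(A + mat d) ** (A + mat d) = (t * t) *\<^sub>R A"
    using d(2) s unfolding mat2_eq_iff t(2)
    by (simp add: matrix_matrix_mult_def sum_2 mat_def algebra_simps)
  then show "sqrt_mat2 A ** sqrt_mat2 A = A"
    using t(1) unfolding e scaled by simp
  \<comment> \<open>For a 2x2 matrix, det (A + d I) = det A + d tr A + d^2; with det A = d^2 this is
    d (tr A + 2 d).\<close>
  have "det (A + mat d) = d * (t * t)"
    unfolding t(2) using d(2) by (simp add: det_2 mat_def algebra_simps)
  moreover have "det (c *\<^sub>R M) = c * c * det M" for c and M :: "real^2^2"
    by (simp add: det_2 algebra_simps)
  then have "det (sqrt_mat2 A) = det (A + mat d) / (t * t)" unfolding e by simp
  ultimately have "det (sqrt_mat2 A) > 0" using d t(1) by simp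
  moreover have "sqrt_mat2 A $ 1 $ 1 > 0" "sqrt_mat2 A $ 1 $ 2 = sqrt_mat2 A $ 2 $ 1"
    using A d t s unfolding e by (simp_all add: mat_def add_pos_pos)
  ultimately show "pos_def (sqrt_mat2 A)" by (intro pos_def_2I)
qed

text \<open>Existence and uniqueness of the root together resolve the definite description in
  \<open>mat_sqrt\<close> to the closed formula \<open>sqrt_mat2\<close>.\<close>

lemma mat_sqrt_2:
  fixes A :: "real^2^2"
  assumes "pos_def A" "A $ 1 $ 2 = A $ 2 $ 1"
  shows "transpose (mat_sqrt A) = mat_sqrt A" "pos_def (mat_sqrt A)" "mat_sqrt A ** mat_sqrt A = A"
proof -
  have "mat_sqrt A = sqrt_mat2 A"
    unfolding mat_sqrt_def using sqrt_mat2[OF assms] by (intro the_equality) (auto intro: sqrt2_unique)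
  then show "transpose (mat_sqrt A) = mat_sqrt A" "pos_def (mat_sqrt A)" "mat_sqrt A ** mat_sqrt A = A"
    using sqrt_mat2[OF assms] by simp_all
qed

section \<open>The spectral norm and the pressure form under a transformation\<close>

lemma norm_mult_le_norm2: "norm ((A :: real^'n^'m) *v v) \<le> norm2 A * norm v"
  unfolding norm2_def by (rule onorm) (simp add: matrix_vector_mul_bounded_linear)

text \<open>With y the transpose of \<open>A\<close> applied to v, the square of |y| is the inner
  product of v with A y; apply Cauchy-Schwarz and cancel one factor |y|.\<close>

lemma norm_transpose_mult_le_norm2: "norm (transpose (A :: real^'n^'m) *v v) \<le> norm2 A * norm v"
proof (cases "transpose A *v v = 0")
  case True
  have "0 \<le> norm2 A" unfolding norm2_def by (rule onorm_pos_le) (simp add: matrix_vector_mul_bounded_linear)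
  then show ?thesis using True by simp
next
  case False
  let ?y = "transpose A *v v"
  have "norm ?y * norm ?y = ?y \<bullet> ?y" by (simp add: dot_square_norm power2_eq_square)
  also have "\<dots> = v \<bullet> (A *v ?y)" by (simp add: dot_lmul_matrix flip: vector_transpose_matrix)
  also have "\<dots> \<le> norm v * norm (A *v ?y)" by (rule norm_cauchy_schwarz)
  also have "\<dots> \<le> norm v * (norm2 A * norm ?y)" by (intro mult_left_mono norm_mult_le_norm2) simp
  finally have "norm ?y * norm ?y \<le> (norm2 A * norm v) * norm ?y" by (simp add: mult_ac)
  then show ?thesis using False by (simp add: mult_le_cancel_right)
qed

text \<open>Let R be the square root of the pressure and \<open>M\<close> = R^-1 T R, so that R M =
  T R. The transpose of this identity carries T^T acting on z to M^T acting on R z. Since the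
  pressure form at y is |R y|^2, its growth under T^T is at most the squared spectral norm of
  \<open>M\<close>.\<close>

lemma f1_pos_and_bound:
  assumes "U \<in> admissible" "det T \<noteq> 0"
  shows "f1 T U > 0"
    and "(transpose T *v z) \<bullet> (pressure U *v (transpose T *v z)) \<le> f1 T U * (z \<bullet> (pressure U *v z))"
proof -
  define R where "R = mat_sqrt (pressure U)"
  define M where "M = matrix_inv R ** T ** R"
  note p = admissibleD(2)[OF assms(1)] pressure_sym
  have R: "transpose R = R" "pos_def R" "R ** R = pressure U"
    unfolding R_def using mat_sqrt_2[OF p] by blast+
  have "det (pressure U) = det R * det R" unfolding R(3)[symmetric] by (simp add: det_mul)
  then have inv: "invertible R" using admissibleD(5)[OF assms(1)] by (auto simp: invertible_det_nz)
  have Rinv: "R ** matrix_inv R = mat 1"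
    using inv unfolding invertible_def matrix_inv_def by (rule someI2_ex) simp
  have RM: "R ** M = T ** R"
    unfolding M_def by (simp add: matrix_mul_assoc Rinv)
  have f: "f1 T U = (norm2 M)\<^sup>2" by (simp add: f1_def M_def R_def)
  have "M \<noteq> 0"
  proof
    assume "M = 0"
    then have "T ** R = 0" using RM by (simp add: matrix_matrix_mult_def vec_eq_iff)
    then have "det (T ** R) = 0" by (simp add: det_2)
    then have "det T * det R = 0" by (simp add: det_mul)
    then show False using assms(2) inv by (simp add: invertible_det_nz)
  qed
  have nn: "0 \<le> norm2 M" unfolding norm2_def by (rule onorm_pos_le) (simp add: matrix_vector_mul_bounded_linear)
  have "norm2 M \<noteq> 0"
  proof
    assume "norm2 M = 0"
    then have "norm (M *v v) \<le> 0" for v using norm_mult_le_norm2[of M v] by simp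
    then have "M = 0" by (simp add: matrix_eq)
    with \<open>M \<noteq> 0\<close> show False by simp
  qed
  then show "f1 T U > 0" using f by simp
  have quad: "y \<bullet> (pressure U *v y) = (norm (R *v y))\<^sup>2" for y
  proof -
    have "y \<bullet> (pressure U *v y) = (y v* R) \<bullet> (R *v y)"
      unfolding R(3)[symmetric] by (simp add: dot_lmul_matrix matrix_vector_mul_assoc)
    also have "y v* R = R *v y" using R(1) by (metis transpose_matrix_vector)
    finally show ?thesis by (simp add: dot_square_norm)
  qed
  have "R *v (transpose T *v z) = transpose M *v (R *v z)"
    using arg_cong[OF RM, of transpose] R(1)
    by (simp add: matrix_transpose_mul matrix_vector_mul_assoc del: transpose_matrix_vector)
  then have "norm (R *v (transpose T *v z)) \<le> norm2 M * norm (R *v z)"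
    using norm_transpose_mult_le_norm2[of M "R *v z"] by simp
  then have "(norm (R *v (transpose T *v z)))\<^sup>2 \<le> (norm2 M * norm (R *v z))\<^sup>2"
    by (rule power_mono) simp
  then show "(transpose T *v z) \<bullet> (pressure U *v (transpose T *v z)) \<le> f1 T U * (z \<bullet> (pressure U *v z))"
    unfolding quad f by (simp add: power_mult_distrib)
qed

text \<open>\<open>theta1 a f\<close> is the nonnegative root of x^2 + (a + f - 1) x - f. This
  polynomial is - f \<le> 0 at 0 and a > 0 at 1, which places the root in [0, 1).\<close>

lemma theta1_root:
  assumes "a > 0" "f \<ge> 0"
  shows "(theta1 a f)\<^sup>2 + (a + f - 1) * theta1 a f = f" "0 \<le> theta1 a f" "theta1 a f < 1"
proof -
  define c where "c = a + f - 1"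
  define s where "s = sqrt (c\<^sup>2 + 4 * f)"
  have s: "s\<^sup>2 = c\<^sup>2 + 4 * f" using assms by (simp add: s_def)
  have th: "theta1 a f = (s - c) / 2" by (simp add: theta1_def s_def c_def)
  have "(s - c)\<^sup>2 + 2 * c * (s - c) = 4 * f" using s by (simp add: power2_eq_square algebra_simps)
  then show "(theta1 a f)\<^sup>2 + (a + f - 1) * theta1 a f = f"
    unfolding th c_def[symmetric] by (simp add: power2_eq_square field_simps)
  have "\<bar>c\<bar> \<le> s" unfolding s_def using assms by (intro real_le_rsqrt) simp
  then show "0 \<le> theta1 a f" unfolding th by simp
  \<comment> \<open>The difference (c + 2)^2 - s^2 equals 4 a.\<close>
  have "s < c + 2"
  proof (rule power2_less_imp_less)
    show "s\<^sup>2 < (c + 2)\<^sup>2" unfolding s using assms by (simp add: c_def power2_eq_square algebra_simps)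
    show "0 \<le> c + 2" using assms by (simp add: c_def)
  qed
  then show "theta1 a f < 1" unfolding th by simp
qed

text \<open>Cauchy--Schwarz with weights: \<open>(A - B)\<^sup>2 \<le> (1 + f / \<theta>) (A\<^sup>2 + (\<theta> / f) B\<^sup>2)\<close>. The quadratic equation
  for \<open>\<theta> = theta1 a f\<close> says exactly \<open>(1 - \<theta>) (1 + f / \<theta>) = a\<close>; the case \<open>f = 0\<close>, where \<open>\<theta>\<close> may vanish,
  is separate.\<close>

lemma theta1_bound:
  fixes A B X :: real
  assumes a: "a > 0" and f: "f \<ge> 0" and B: "B\<^sup>2 \<le> f * X" and X: "X \<ge> 0"
  shows "(1 - theta1 a f) * (A - B)\<^sup>2 \<le> a * (A\<^sup>2 + theta1 a f * X)"
proof -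
  define \<theta> where "\<theta> = theta1 a f"
  have root: "\<theta>\<^sup>2 + (a + f - 1) * \<theta> = f" and \<theta>: "0 \<le> \<theta>" "\<theta> < 1"
    using theta1_root[OF a f] by (simp_all add: \<theta>_def)
  show ?thesis
  proof (cases "f = 0")
    case True
    then have "B = 0" using B by simp
    have "\<theta> * (\<theta> + a - 1) = 0" using root True by (simp add: power2_eq_square algebra_simps)
    \<comment> \<open>The quadratic leaves \<theta> = 1 - a or \<theta> = 0. In the latter case the
      definition, with f = 0, reads |a - 1| = a - 1 and gives a \<ge> 1.\<close>
    then have "1 - \<theta> \<le> a" using \<theta> True by (auto simp: \<theta>_def theta1_def)
    then have "(1 - \<theta>) * A\<^sup>2 \<le> a * A\<^sup>2" by (intro mult_right_mono) simp_all
    also have "\<dots> \<le> a * (A\<^sup>2 + \<theta> * X)" using a \<theta> X by (intro mult_left_mono) simp_all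
    finally show ?thesis using \<open>B = 0\<close> by (simp add: \<theta>_def)
  next
    case False
    with f have f0: "f > 0" by simp
    have "\<theta> \<noteq> 0" using root f0 by auto
    with \<theta> have t0: "\<theta> > 0" by simp
    have key: "(1 - \<theta>) * (\<theta> + f) = a * \<theta>" using root by (simp add: power2_eq_square algebra_simps)
    have "0 \<le> (f * A + \<theta> * B)\<^sup>2" by simp
    then have "\<theta> * f * (A - B)\<^sup>2 \<le> (\<theta> + f) * (f * A\<^sup>2 + \<theta> * B\<^sup>2)"
      by (simp add: power2_eq_square algebra_simps)
    also have "\<dots> \<le> (\<theta> + f) * (f * A\<^sup>2 + \<theta> * (f * X))"
      using B t0 f0 by (intro mult_left_mono add_left_mono) simp_all
    finally have "f * (\<theta> * (A - B)\<^sup>2) \<le> f * ((\<theta> + f) * (A\<^sup>2 + \<theta> * X))"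
      by (simp add: algebra_simps)
    then have "\<theta> * (A - B)\<^sup>2 \<le> (\<theta> + f) * (A\<^sup>2 + \<theta> * X)" using f0 by simp
    then have "(1 - \<theta>) * (\<theta> * (A - B)\<^sup>2) \<le> (1 - \<theta>) * ((\<theta> + f) * (A\<^sup>2 + \<theta> * X))"
      using \<theta> by (intro mult_left_mono) simp_all
    also have "\<dots> = a * \<theta> * (A\<^sup>2 + \<theta> * X)" using key by (simp add: mult.assoc[symmetric])
    finally have "\<theta> * ((1 - \<theta>) * (A - B)\<^sup>2) \<le> \<theta> * (a * (A\<^sup>2 + \<theta> * X))" by (simp add: mult_ac)
    then show ?thesis using t0 by (simp add: \<theta>_def)
  qed
qed

section \<open>Domination of the modified state by the original state\<close>

lemma xi_star_pos:
  assumes "U \<in> admissible" "det T \<noteq> 0" "0 \<le> g" "0 \<le> h"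
  shows "0 < xi_star T U g h"
  using f1_pos_and_bound(1)[OF assms(1,2)] theta1_root(3) assms(3,4) by (simp add: xi_star_def)

text \<open>In the completed squares, A^2 and (A - B)^2 are the kinetic parts before and after the
  modification. The pressure part grows by at most the factor a, and B^2 is controlled by h times
  the pressure part. \<open>theta1\<close> splits X into \<theta> X, which pays for the shift
  \<open>B\<close>, and (1 - \<theta>) X, which pays for the growth.\<close>

lemma xi_star_qform_modify:
  assumes U: "U \<in> admissible" and T: "det T \<noteq> 0" and h: "0 \<le> h"
    and q: "rho U * (velocity U \<bullet> z - velocity U \<bullet> (transpose T *v z))\<^sup>2 \<le> h * (z \<bullet> (pressure U *v z))"
  shows "xi_star T U g h * qform (modify T U) w z \<le> qform U w z"
proof -
  define a where "a = f1 T U"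
  define X where "X = z \<bullet> (pressure U *v z)"
  define A where "A = sqrt (rho U) * (w + velocity U \<bullet> z)"
  define B where "B = sqrt (rho U) * (velocity U \<bullet> z - velocity U \<bullet> (transpose T *v z))"
  note ad = admissibleD[OF U]
  have a: "a > 0" using f1_pos_and_bound(1)[OF U T] by (simp add: a_def)
  have X: "X \<ge> 0" using ad(2) by (cases "z = 0") (auto simp: X_def pos_def_def less_imp_le)
  have B: "B\<^sup>2 \<le> h * X" using q ad(1) by (simp add: B_def X_def power_mult_distrib)
  have "qform (modify T U) w z = (A - B)\<^sup>2 + (transpose T *v z) \<bullet> (pressure U *v (transpose T *v z))"
    using ad(1) by (simp add: qform_modify qform_complete_square A_def B_def power_mult_distrib flip: right_diff_distrib)
  also have "\<dots> \<le> (A - B)\<^sup>2 + a * X" using f1_pos_and_bound(2)[OF U T, of z] by (simp add: a_def X_def)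
  finally have 1: "qform (modify T U) w z \<le> (A - B)\<^sup>2 + a * X" .
  \<comment> \<open>The maximum in \<open>xi_star\<close> only makes the factor smaller than the one
    built from \<open>h\<close> alone.\<close>
  have "xi_star T U g h * qform (modify T U) w z \<le> (1 - theta1 a h) / a * qform (modify T U) w z"
    using a qform_nonneg[OF modify_admissible[OF U T]] unfolding xi_star_def a_def[symmetric]
    by (intro mult_right_mono divide_right_mono) simp_all
  also have "\<dots> \<le> (1 - theta1 a h) / a * ((A - B)\<^sup>2 + a * X)"
    using 1 theta1_root(3)[OF a h] a by (intro mult_left_mono) simp_all
  also have "\<dots> = ((1 - theta1 a h) * (A - B)\<^sup>2) / a + (1 - theta1 a h) * X" using a by (simp add: field_simps)
  also have "\<dots> \<le> (A\<^sup>2 + theta1 a h * X) + (1 - theta1 a h) * X"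
    using theta1_bound[OF a h B X, of A] a by (simp add: divide_le_eq mult.commute)
  also have "\<dots> = A\<^sup>2 + X" by (simp add: algebra_simps)
  also have "\<dots> = qform U w z" using ad(1) by (simp add: qform_complete_square A_def X_def power_mult_distrib)
  finally show ?thesis .
qed

text \<open>As the second row of \<open>T\<close> is (0, 1), the shift of u z caused by T^T is a
  multiple of the first component of z. \<open>quad_ge_component\<close> bounds the square of that
  component by the pressure form, and the resulting constant is exactly f^(3).\<close>

lemma xi_star_x:
  assumes U: "U \<in> admissible" and T: "det T \<noteq> 0" "T $ 2 $ 1 = 0" "T $ 2 $ 2 = 1"
  shows "0 < xi_star_x T U" "xi_star_x T U * qform (modify T U) w z \<le> qform U w z"
proof -
  define q where "q = ((1 - T $ 1 $ 1) * mom U $ 1 - T $ 1 $ 2 * mom U $ 2)\<^sup>2"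
  define h where "h = q * pressure U $ 2 $ 2 / (rho U * det (pressure U))"
  note ad = admissibleD[OF U]
  have q0: "0 \<le> q" by (simp add: q_def)
  have e: "xi_star_x T U = xi_star T U (q / (rho U * pressure U $ 1 $ 1)) h"
    by (simp add: xi_star_x_def q_def h_def Let_def)
  have h0: "0 \<le> h" using ad q0 by (simp add: h_def)
  show "0 < xi_star_x T U" unfolding e using ad q0 h0 by (intro xi_star_pos U T(1)) simp_all
  have ve: "velocity U \<bullet> z - velocity U \<bullet> (transpose T *v z)
      = z $ 1 * ((1 - T $ 1 $ 1) * mom U $ 1 - T $ 1 $ 2 * mom U $ 2) / rho U"
    using T ad(1) by (simp add: velocity_def inner_real2 transpose_def matrix_vector_mult_def sum_2 field_simps)
  have "rho U * (velocity U \<bullet> z - velocity U \<bullet> (transpose T *v z))\<^sup>2 = q / rho U * (z $ 1)\<^sup>2"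
    unfolding ve q_def using ad(1) by (simp add: power2_eq_square)
  also have "\<dots> = q / (rho U * det (pressure U)) * (det (pressure U) * (z $ 1)\<^sup>2)"
    using ad by (simp add: field_simps)
  also have "\<dots> \<le> q / (rho U * det (pressure U)) * (pressure U $ 2 $ 2 * (z \<bullet> (pressure U *v z)))"
    using ad q0 by (intro mult_left_mono quad_ge_component pressure_sym) simp_all
  also have "\<dots> = h * (z \<bullet> (pressure U *v z))" by (simp add: h_def)
  finally show "xi_star_x T U * qform (modify T U) w z \<le> qform U w z"
    unfolding e by (intro xi_star_qform_modify U T(1) h0)
qed

lemma xi_star_y:
  assumes U: "U \<in> admissible" and T: "det T \<noteq> 0" "T $ 1 $ 1 = 1" "T $ 1 $ 2 = 0"
  shows "0 < xi_star_y T U" "xi_star_y T U * qform (modify T U) w z \<le> qform U w z"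
proof -
  define q where "q = ((1 - T $ 2 $ 2) * mom U $ 2 - T $ 2 $ 1 * mom U $ 1)\<^sup>2"
  define h where "h = q * pressure U $ 1 $ 1 / (rho U * det (pressure U))"
  note ad = admissibleD[OF U]
  have q0: "0 \<le> q" by (simp add: q_def)
  have e: "xi_star_y T U = xi_star T U (q / (rho U * pressure U $ 2 $ 2)) h"
    by (simp add: xi_star_y_def q_def h_def Let_def)
  have h0: "0 \<le> h" using ad q0 by (simp add: h_def)
  show "0 < xi_star_y T U" unfolding e using ad q0 h0 by (intro xi_star_pos U T(1)) simp_all
  have ve: "velocity U \<bullet> z - velocity U \<bullet> (transpose T *v z)
      = z $ 2 * ((1 - T $ 2 $ 2) * mom U $ 2 - T $ 2 $ 1 * mom U $ 1) / rho U"
    using T ad(1) by (simp add: velocity_def inner_real2 transpose_def matrix_vector_mult_def sum_2 field_simps)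
  have "rho U * (velocity U \<bullet> z - velocity U \<bullet> (transpose T *v z))\<^sup>2 = q / rho U * (z $ 2)\<^sup>2"
    unfolding ve q_def using ad(1) by (simp add: power2_eq_square)
  also have "\<dots> = q / (rho U * det (pressure U)) * (det (pressure U) * (z $ 2)\<^sup>2)"
    using ad by (simp add: field_simps)
  also have "\<dots> \<le> q / (rho U * det (pressure U)) * (pressure U $ 1 $ 1 * (z \<bullet> (pressure U *v z)))"
    using ad q0 by (intro mult_left_mono quad_ge_component pressure_sym) simp_all
  also have "\<dots> = h * (z \<bullet> (pressure U *v z))" by (simp add: h_def)
  finally show "xi_star_y T U * qform (modify T U) w z \<le> qform U w z"
    unfolding e by (intro xi_star_qform_modify U T(1) h0)
qed

section \<open>Exactness of the tensor Gauss rule\<close>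

lemma integral_affine_power:
  fixes a b c d :: real
  assumes "a \<le> b" "d \<noteq> 0"
  shows "integral {a..b} (\<lambda>t. (c + d * t) ^ n) =
    ((c + d * b) ^ Suc n - (c + d * a) ^ Suc n) / (d * of_nat (Suc n))"
proof -
  have "((\<lambda>t. (c + d * t) ^ n) has_integral
      ((c + d * b) ^ Suc n / (d * of_nat (Suc n)) - (c + d * a) ^ Suc n / (d * of_nat (Suc n)))) {a..b}"
    using assms
    by (intro fundamental_theorem_of_calculus)
       (auto intro!: derivative_eq_intros simp flip: has_real_derivative_iff_has_vector_derivative
          simp del: of_nat_Suc power_Suc)
  then show ?thesis by (simp add: integral_unique diff_divide_distrib)
qed

text \<open>Binomial expansion reduces an affine argument to the monomials in
  \<open>gauss_rule\<close>; this moves the rule from the reference interval to a cell.\<close>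

lemma gauss_rule_affine_power:
  assumes G: "gauss_rule D" and n: "n < 2 * nq D"
  shows "(\<Sum>\<mu>=1..nq D. wt D \<mu> * (c + d * node D \<mu>) ^ n) = integral {-1/2..1/2} (\<lambda>t. (c + d * t) ^ n)"
proof -
  let ?b = "\<lambda>j. of_nat (n choose j) * d ^ j * c ^ (n - j) :: real"
  have e: "(c + d * t) ^ n = (\<Sum>j\<le>n. ?b j * t ^ j)" for t :: real
    by (subst add.commute) (simp add: binomial_ring power_mult_distrib mult_ac)
  have "(\<Sum>\<mu>=1..nq D. wt D \<mu> * (c + d * node D \<mu>) ^ n) = (\<Sum>j\<le>n. ?b j * (\<Sum>\<mu>=1..nq D. wt D \<mu> * node D \<mu> ^ j))"
    unfolding e sum_distrib_left by (subst sum.swap) (simp add: mult_ac)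
  also have "\<dots> = (\<Sum>j\<le>n. ?b j * integral {-1/2..1/2} (\<lambda>x. x ^ j))"
    using G n by (intro sum.cong) (auto simp: gauss_rule_def)
  also have "\<dots> = integral {-1/2..1/2} (\<lambda>t. \<Sum>j\<le>n. ?b j * t ^ j)"
    by (subst integral_sum) (auto intro!: integrable_continuous_interval continuous_intros)
  finally show ?thesis by (simp add: e)
qed

text \<open>The affine change of variables is carried out by evaluating both integrals through their
  antiderivatives.\<close>

lemma gauss_rule_xface:
  assumes "gauss_rule D" "n < 2 * nq D" "0 < dx D"
  shows "integral {xface D (i - 1)..xface D i} (\<lambda>x. x ^ n) = dx D * (\<Sum>\<mu>=1..nq D. wt D \<mu> * xgauss D i \<mu> ^ n)"
proof -
  have "(\<Sum>\<mu>=1..nq D. wt D \<mu> * xgauss D i \<mu> ^ n)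
      = (\<Sum>\<mu>=1..nq D. wt D \<mu> * ((orig_x D + of_int i * dx D) + dx D * node D \<mu>) ^ n)"
    by (simp add: xgauss_def algebra_simps)
  also have "\<dots> = (xface D i ^ Suc n - xface D (i - 1) ^ Suc n) / (dx D * of_nat (Suc n))"
    using assms(3) unfolding gauss_rule_affine_power[OF assms(1,2)]
    by (subst integral_affine_power) (auto simp: xface_def algebra_simps simp del: power_Suc)
  finally show ?thesis
    using assms(3) integral_affine_power[of "xface D (i - 1)" "xface D i" 1 0 n]
    by (simp add: xface_def del: power_Suc of_nat_Suc)
qed

lemma gauss_rule_yface:
  assumes "gauss_rule D" "n < 2 * nq D" "0 < dy D"
  shows "integral {yface D (l - 1)..yface D l} (\<lambda>x. x ^ n) = dy D * (\<Sum>\<mu>=1..nq D. wt D \<mu> * ygauss D l \<mu> ^ n)"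
proof -
  have "(\<Sum>\<mu>=1..nq D. wt D \<mu> * ygauss D l \<mu> ^ n)
      = (\<Sum>\<mu>=1..nq D. wt D \<mu> * ((orig_y D + of_int l * dy D) + dy D * node D \<mu>) ^ n)"
    by (simp add: ygauss_def algebra_simps)
  also have "\<dots> = (yface D l ^ Suc n - yface D (l - 1) ^ Suc n) / (dy D * of_nat (Suc n))"
    using assms(3) unfolding gauss_rule_affine_power[OF assms(1,2)]
    by (subst integral_affine_power) (auto simp: yface_def algebra_simps simp del: power_Suc)
  finally show ?thesis
    using assms(3) integral_affine_power[of "yface D (l - 1)" "yface D l" 1 0 n]
    by (simp add: yface_def del: power_Suc of_nat_Suc)
qed

section \<open>Cell averages by tensor quadrature\<close>

lemma continuous_Pk: "f \<in> Pk k \<Longrightarrow> continuous_on A (\<lambda>(x, y). f x y)"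
  by (auto simp: Pk_def case_prod_unfold intro!: continuous_intros)

lemma integral_box_monomial:
  fixes a b c d :: real
  shows "integral ({a..b} \<times> {c..d}) (\<lambda>(x, y). C * x ^ m * y ^ n)
    = C * integral {a..b} (\<lambda>x. x ^ m) * integral {c..d} (\<lambda>y. y ^ n)"
proof -
  have "integral (cbox (a, c) (b, d)) (\<lambda>(x, y). C * x ^ m * y ^ n)
      = integral {a..b} (\<lambda>x. integral {c..d} (\<lambda>y. C * x ^ m * y ^ n))"
    by (subst integral_prod_continuous)
       (auto simp: case_prod_unfold intro!: continuous_intros)
  then show ?thesis by (simp add: cbox_Pair_eq mult_ac)
qed

text \<open>Each monomial of total degree at most \<open>k\<close> has degree at most
  \<open>k\<close> in either variable. Fubini and the two one-dimensional rules therefore integrate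
  it exactly.\<close>

lemma integral_cell_Pk:
  assumes G: "gauss_rule D" and k: "k < 2 * nq D" and d: "0 < dx D" "0 < dy D" and f: "f \<in> Pk k"
  shows "integral (cell_box D (i, l)) (\<lambda>(x, y). f x y)
    = dx D * dy D * (\<Sum>\<mu>1=1..nq D. \<Sum>\<mu>2=1..nq D. wt D \<mu>1 * wt D \<mu>2 * f (xgauss D i \<mu>1) (ygauss D l \<mu>2))"
proof -
  obtain c where c: "\<And>x y. f x y = (\<Sum>a\<le>k. \<Sum>b\<le>k - a. c a b * x ^ a * y ^ b)"
    using f by (auto simp: Pk_def)
  define B where "B = cell_box D (i, l)"
  define gx where "gx = (\<lambda>a. \<Sum>\<mu>=1..nq D. wt D \<mu> * xgauss D i \<mu> ^ a)"
  define gy where "gy = (\<lambda>b. \<Sum>\<mu>=1..nq D. wt D \<mu> * ygauss D l \<mu> ^ b)"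
  have int: "g integrable_on B" if "continuous_on UNIV g" for g :: "real \<times> real \<Rightarrow> real"
  proof -
    have "g integrable_on cbox (xface D (i - 1), yface D (l - 1)) (xface D i, yface D l)"
      by (intro integrable_continuous continuous_on_subset[OF that]) simp
    then show ?thesis by (simp add: B_def cbox_Pair_eq)
  qed
  have mono: "integral B (\<lambda>p. c a b * fst p ^ a * snd p ^ b) = c a b * (dx D * gx a) * (dy D * gy b)"
    if "a \<le> k" "b \<le> k" for a b
    using that k integral_box_monomial[where a = "xface D (i - 1)" and b = "xface D i"
        and c = "yface D (l - 1)" and d = "yface D l" and C = "c a b" and m = a and n = b]
    by (simp add: B_def gx_def gy_def gauss_rule_xface[OF G _ d(1)] gauss_rule_yface[OF G _ d(2)] case_prod_unfold)
  have "integral B (\<lambda>(x, y). f x y) = integral B (\<lambda>p. \<Sum>a\<le>k. \<Sum>b\<le>k - a. c a b * fst p ^ a * snd p ^ b)"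
    by (simp add: c case_prod_unfold)
  also have "\<dots> = (\<Sum>a\<le>k. integral B (\<lambda>p. \<Sum>b\<le>k - a. c a b * fst p ^ a * snd p ^ b))"
    by (intro integral_sum int) (auto intro!: continuous_intros)
  also have "\<dots> = (\<Sum>a\<le>k. \<Sum>b\<le>k - a. integral B (\<lambda>p. c a b * fst p ^ a * snd p ^ b))"
    by (intro sum.cong refl integral_sum int) (auto intro!: continuous_intros)
  also have "\<dots> = (\<Sum>a\<le>k. \<Sum>b\<le>k - a. c a b * (dx D * gx a) * (dy D * gy b))"
    by (intro sum.cong refl mono) auto
  also have "\<dots> = dx D * dy D * (\<Sum>a\<le>k. \<Sum>b\<le>k - a. c a b * (gx a * gy b))"
    by (simp add: sum_distrib_left mult_ac)
  also have "(\<Sum>a\<le>k. \<Sum>b\<le>k - a. c a b * (gx a * gy b)) =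
    (\<Sum>a\<le>k. \<Sum>b\<le>k - a. \<Sum>\<mu>1=1..nq D. \<Sum>\<mu>2=1..nq D. wt D \<mu>1 * wt D \<mu>2 * (c a b * xgauss D i \<mu>1 ^ a * ygauss D l \<mu>2 ^ b))"
    unfolding gx_def gy_def sum_product by (simp add: sum_distrib_left mult_ac)
  \<comment> \<open>The quadrature sums are moved outwards one at a time, since the range of b
    depends on a.\<close>
  also have "\<dots> = (\<Sum>a\<le>k. \<Sum>\<mu>1=1..nq D. \<Sum>b\<le>k - a. \<Sum>\<mu>2=1..nq D. wt D \<mu>1 * wt D \<mu>2 * (c a b * xgauss D i \<mu>1 ^ a * ygauss D l \<mu>2 ^ b))"
    by (rule sum.cong[OF refl], rule sum.swap)
  also have "\<dots> = (\<Sum>\<mu>1=1..nq D. \<Sum>a\<le>k. \<Sum>b\<le>k - a. \<Sum>\<mu>2=1..nq D. wt D \<mu>1 * wt D \<mu>2 * (c a b * xgauss D i \<mu>1 ^ a * ygauss D l \<mu>2 ^ b))"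
    by (rule sum.swap)
  also have "\<dots> = (\<Sum>\<mu>1=1..nq D. \<Sum>a\<le>k. \<Sum>\<mu>2=1..nq D. \<Sum>b\<le>k - a. wt D \<mu>1 * wt D \<mu>2 * (c a b * xgauss D i \<mu>1 ^ a * ygauss D l \<mu>2 ^ b))"
    by (rule sum.cong[OF refl], rule sum.cong[OF refl], rule sum.swap)
  also have "\<dots> = (\<Sum>\<mu>1=1..nq D. \<Sum>\<mu>2=1..nq D. \<Sum>a\<le>k. \<Sum>b\<le>k - a. wt D \<mu>1 * wt D \<mu>2 * (c a b * xgauss D i \<mu>1 ^ a * ygauss D l \<mu>2 ^ b))"
    by (rule sum.cong[OF refl], rule sum.swap)
  also have "\<dots> = (\<Sum>\<mu>1=1..nq D. \<Sum>\<mu>2=1..nq D. wt D \<mu>1 * wt D \<mu>2 * f (xgauss D i \<mu>1) (ygauss D l \<mu>2))"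
    by (simp add: c sum_distrib_left)
  finally show ?thesis by (simp add: B_def)
qed

text \<open>Transfers the scalar quadrature and decomposition identities to states. Taking
  components under the integral rests on integrability, which follows from continuity of the
  polynomials.\<close>

lemma cell_avg_component:
  assumes U: "U \<in> Vh_state D k" and K: "K \<in> ext_cells D"
  shows "cell_avg D U K $ j = cell_avg D (\<lambda>K x y. U K x y $ j) K"
proof -
  obtain i l where Kil: "K = (i, l)" by (cases K)
  have "continuous_on A (\<lambda>p. \<chi> j. (case p of (x, y) \<Rightarrow> U K x y $ j))" for A
    using U K by (intro continuous_on_vec_lambda continuous_Pk) (auto simp: Vh_state_def Vh_def)
  then have "(\<lambda>p. \<chi> j. (case p of (x, y) \<Rightarrow> U K x y $ j)) integrable_on
      cbox (xface D (i - 1), yface D (l - 1)) (xface D i, yface D l)"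
    by (rule integrable_continuous)
  then have "(\<lambda>(x, y). U K x y) integrable_on cell_box D K"
    by (simp add: Kil cbox_Pair_eq case_prod_unfold)
  from integral_component_eq_cart[OF this, of j] show ?thesis
    by (simp add: cell_avg_def case_prod_unfold)
qed

lemma cell_avg_gauss:
  assumes G: "gauss_rule D" and k: "k < 2 * nq D" and d: "0 < dx D" "0 < dy D"
    and U: "U \<in> Vh_state D k" and K: "K \<in> ext_cells D"
  shows "cell_avg D U K = (\<Sum>\<mu>1=1..nq D. \<Sum>\<mu>2=1..nq D. (wt D \<mu>1 * wt D \<mu>2) *\<^sub>R at_gauss D U K \<mu>1 \<mu>2)"
proof -
  obtain i l where Kil: "K = (i, l)" by (cases K)
  have "cell_avg D U K $ j = (\<Sum>\<mu>1=1..nq D. \<Sum>\<mu>2=1..nq D. (wt D \<mu>1 * wt D \<mu>2) *\<^sub>R at_gauss D U K \<mu>1 \<mu>2) $ j" for j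
  proof -
    have "(\<lambda>x y. U K x y $ j) \<in> Pk k" using U K by (auto simp: Vh_state_def Vh_def)
    from integral_cell_Pk[OF G k d this, of i l] show ?thesis
      using d unfolding cell_avg_component[OF U K]
      by (simp add: cell_avg_def Kil at_gauss_def)
  qed
  then show ?thesis by (simp add: vec_eq_iff)
qed

lemma cell_avg_feasible:
  assumes F: "feasible_decomposition D k" and U: "U \<in> Vh_state D k" and K: "(i, l) \<in> ext_cells D"
  shows "cell_avg D U (i, l) =
          (\<Sum>\<mu>=1..nq D. wt D \<mu> *\<^sub>R
             (om1m D *\<^sub>R trace_x D U Minus i l \<mu> + om1p D *\<^sub>R trace_x D U Plus (i - 1) l \<mu>
              + om2m D *\<^sub>R trace_y D U Minus i l \<mu> + om2p D *\<^sub>R trace_y D U Plus i (l - 1) \<mu>))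
          + (\<Sum>s=1..ns D. omt D s *\<^sub>R U (i, l) (fst (pt D (i, l) s)) (snd (pt D (i, l) s)))"
    (is "_ = ?R")
proof -
  have "cell_avg D U (i, l) $ j = ?R $ j" for j
  proof -
    have "(\<lambda>K x y. U K x y $ j) \<in> Vh D k" using U by (auto simp: Vh_state_def)
    with F K show ?thesis unfolding cell_avg_component[OF U K]
      by (fastforce simp: feasible_decomposition_def trace_x_def trace_y_def)
  qed
  then show ?thesis by (simp add: vec_eq_iff)
qed

section \<open>Flux and source contributions\<close>

text \<open>Replacing the (1,1) entry by the larger interface value can only increase the
  determinant, so the quotient under the root stays positive.\<close>

lemma T_x_det_pos:
  assumes pd: "pos_def (trace_x D (p_e Q) s i l \<mu>)"
  shows "det (T_x D Q s i l \<mu>) > 0" "T_x D Q s i l \<mu> $ 2 $ 1 = 0" "T_x D Q s i l \<mu> $ 2 $ 2 = 1"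
proof -
  define p where "p = trace_x D (p_e Q) s i l \<mu>"
  define p' where "p' = mat2 (p11_star D Q i l \<mu>) (C0 Q) (C0 Q) (p $ 2 $ 2)"
  have c: "p $ 1 $ 1 = trace_x D (p11_e Q) s i l \<mu>" "p $ 1 $ 2 = C0 Q" "p $ 2 $ 1 = C0 Q"
    by (simp_all add: p_def trace_x_def p_e_def)
  note p = pos_def_2D[OF pd[folded p_def], unfolded c(2,3), OF refl]
  have "p $ 1 $ 1 \<le> p11_star D Q i l \<mu>" by (cases s) (simp_all add: c p11_star_def)
  then have "p $ 1 $ 1 * p $ 2 $ 2 \<le> p11_star D Q i l \<mu> * p $ 2 $ 2" using p by (intro mult_right_mono) simp_all
  then have "det p \<le> det p'" by (simp add: det_2 p'_def c)
  then have "0 < sqrt (det p' / det p)" using p by simp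
  then show "det (T_x D Q s i l \<mu>) > 0" "T_x D Q s i l \<mu> $ 2 $ 1 = 0" "T_x D Q s i l \<mu> $ 2 $ 2 = 1"
    by (simp_all add: T_x_def Let_def det_2[of "mat2 _ _ 0 1"] p_def[symmetric] p'_def[symmetric])
qed

lemma T_y_det_pos:
  assumes pd: "pos_def (trace_y D (p_e Q) s i l \<mu>)"
  shows "det (T_y D Q s i l \<mu>) > 0" "T_y D Q s i l \<mu> $ 1 $ 1 = 1" "T_y D Q s i l \<mu> $ 1 $ 2 = 0"
proof -
  define p where "p = trace_y D (p_e Q) s i l \<mu>"
  define p' where "p' = mat2 (p $ 1 $ 1) (C0 Q) (C0 Q) (p22_star D Q i l \<mu>)"
  have c: "p $ 2 $ 2 = trace_y D (p22_e Q) s i l \<mu>" "p $ 1 $ 2 = C0 Q" "p $ 2 $ 1 = C0 Q"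
    by (simp_all add: p_def trace_y_def p_e_def)
  note p = pos_def_2D[OF pd[folded p_def], unfolded c(2,3), OF refl]
  have "p $ 2 $ 2 \<le> p22_star D Q i l \<mu>" by (cases s) (simp_all add: c p22_star_def)
  then have "p $ 1 $ 1 * p $ 2 $ 2 \<le> p $ 1 $ 1 * p22_star D Q i l \<mu>" using p by (intro mult_left_mono) simp_all
  then have "det p \<le> det p'" by (simp add: det_2 p'_def c)
  then have "0 < sqrt (det p' / det p)" using p by simp
  then show "det (T_y D Q s i l \<mu>) > 0" "T_y D Q s i l \<mu> $ 1 $ 1 = 1" "T_y D Q s i l \<mu> $ 1 $ 2 = 0"
    by (simp_all add: T_y_def Let_def det_2[of "mat2 1 0 _ _"] p_def[symmetric] p'_def[symmetric])
qed

section \<open>Flux differences across a cell\<close>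

lemma alpha_pos:
  assumes "U \<in> admissible"
  shows "alpha1 U > 0" "alpha2 U > 0"
  using admissibleD[OF assms] by (simp_all add: alpha1_def alpha2_def add_nonneg_pos)

text \<open>\<open>eta1_R\<close> and \<open>eta2_T\<close> list the middle state first, whereas the
  flux property lists the left or lower one first.\<close>

lemma insert_rotate_3: "{b, c, a} = {a, b, c}"
  by blast

text \<open>Here \<open>V\<close> is a trace with decomposition weight \<omega>, \<open>UM\<close>
  its modified state and \<theta> the available share of the cell average. The chain is \<theta>
  \<omega> V \<ge> \<theta> \<omega> \<xi> UM in the sense of forms, and the right-hand side absorbs
  the flux difference by the property of the numerical flux.\<close>

lemma flux_step:
  assumes F: "flux_preserves_admissible F a"
    and adm: "UL \<in> admissible" "UM \<in> admissible" "UR \<in> admissible"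
    and a: "0 < a UM" and wz: "(w, z) \<noteq> 0"
    and \<xi>: "0 < \<xi>" "\<xi> * qform UM w z \<le> qform V w z"
    and pos: "0 < dt" "0 < h" "0 < \<omega>"
    and W: "W = {UL, UM, UR}" and \<theta>: "dt * (2 / \<xi> * (MAX U\<in>W. a U) / (\<omega> * h)) \<le> \<theta>"
  shows "0 < \<theta>"
    and "0 < \<theta> * (\<omega> * qform V w z) - dt / h * (qform (F UM UR) w z - qform (F UL UM) w z)"
proof -
  define M where "M = (MAX U\<in>{UL, UM, UR}. a U)"
  define \<Delta> where "\<Delta> = qform (F UM UR) w z - qform (F UL UM) w z"
  have "a UM \<le> M" unfolding M_def by (intro Max_ge) auto
  then have "0 < M" using a by simp
  then have "0 < dt * (2 / \<xi> * M / (\<omega> * h))" using \<xi> pos by simp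
  then show t: "0 < \<theta>" using \<theta> by (simp add: M_def W)
  \<comment> \<open>Scaling UM - r (flux difference) by \<omega> \<xi> \<theta> has to produce the
    coefficient dt / h. The factor 2 / \<xi> in the CFL bound is what makes r times the maximal
    speed at most 1/2.\<close>
  define r where "r = dt / (\<omega> * h * \<xi> * \<theta>)"
  have "2 * (r * M) * \<theta> = dt * (2 / \<xi> * M / (\<omega> * h))" using t by (simp add: r_def mult_ac)
  also have "\<dots> \<le> 1 * \<theta>" using \<theta> by (simp add: M_def W)
  finally have "2 * (r * M) \<le> 1" using t by (rule mult_right_le_imp_le)
  then have r: "0 < r" "r * M \<le> 1/2" using t \<xi> pos by (simp_all add: r_def)
  then have "UM - r *\<^sub>R (F UM UR - F UL UM) \<in> admissible"
    using F adm unfolding flux_preserves_admissible_def M_def by blast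
  then have "0 < qform UM w z - r * \<Delta>"
    using wz by (auto simp: admissible_iff_qform \<Delta>_def dest!: spec[of _ w] spec[of _ z])
  then have "0 < (\<omega> * \<xi> * \<theta>) * (qform UM w z - r * \<Delta>)"
    using \<xi> t pos by simp
  also have "\<dots> = \<theta> * (\<omega> * (\<xi> * qform UM w z)) - dt / h * \<Delta>"
    using \<xi> t pos by (simp add: r_def right_diff_distrib)
  also have "\<dots> \<le> \<theta> * (\<omega> * qform V w z) - dt / h * \<Delta>"
    using \<xi> t pos by simp
  finally show "0 < \<theta> * (\<omega> * qform V w z) - dt / h * (qform (F UM UR) w z - qform (F UL UM) w z)"
    by (simp add: \<Delta>_def)
qed

section \<open>Traces of admissible data and the four edges of a cell\<close>

locale admissible_data =
  fixes D :: disc and Q :: equil and U :: "state broken"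
  assumes equilibrium_pos:
      "\<forall>K\<in>ext_cells D. \<forall>(x, y)\<in>point_set D K. rho_e Q K x y > 0 \<and> pos_def (p_e Q K x y)"
    and solution_adm:
      "\<forall>K\<in>ext_cells D. \<forall>(x, y)\<in>point_set D K. U K x y \<in> admissible"
begin

lemma trace_admissible:
  assumes \<mu>: "\<mu> \<in> {1..nq D}"
  shows "(i + shift s, l) \<in> ext_cells D \<Longrightarrow> trace_x D U s i l \<mu> \<in> admissible"
    and "(i, l + shift s) \<in> ext_cells D \<Longrightarrow> trace_y D U s i l \<mu> \<in> admissible"
    and "(i + shift s, l) \<in> ext_cells D \<Longrightarrow> pos_def (trace_x D (p_e Q) s i l \<mu>)"
    and "(i, l + shift s) \<in> ext_cells D \<Longrightarrow> pos_def (trace_y D (p_e Q) s i l \<mu>)"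
proof -
  \<comment> \<open>For \<open>Plus\<close> the interface i + 1/2 is the left edge of cell i + 1,
    for \<open>Minus\<close> the right edge of cell i.\<close>
  have x: "(xface D i, ygauss D l \<mu>) \<in> point_set D (i + shift s, l)"
    unfolding point_set.simps by (intro UnI1 UN_I[OF \<mu>]) (cases s; simp)
  have y: "(xgauss D i \<mu>, yface D l) \<in> point_set D (i, l + shift s)"
    unfolding point_set.simps by (intro UnI1 UN_I[OF \<mu>]) (cases s; simp)
  show "trace_x D U s i l \<mu> \<in> admissible" "pos_def (trace_x D (p_e Q) s i l \<mu>)"
    if "(i + shift s, l) \<in> ext_cells D"
    using bspec[OF bspec[OF solution_adm that] x] bspec[OF bspec[OF equilibrium_pos that] x]
    by (simp_all add: trace_x_def)
  show "trace_y D U s i l \<mu> \<in> admissible" "pos_def (trace_y D (p_e Q) s i l \<mu>)"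
    if "(i, l + shift s) \<in> ext_cells D"
    using bspec[OF bspec[OF solution_adm that] y] bspec[OF bspec[OF equilibrium_pos that] y]
    by (simp_all add: trace_y_def)
qed

lemma Uhat_admissible:
  assumes \<mu>: "\<mu> \<in> {1..nq D}"
  shows "(i + shift s, l) \<in> ext_cells D \<Longrightarrow> Uhat_x D Q U s i l \<mu> \<in> admissible"
    and "(i, l + shift s) \<in> ext_cells D \<Longrightarrow> Uhat_y D Q U s i l \<mu> \<in> admissible"
  using trace_admissible[OF \<mu>, where i = i and s = s and l = l] T_x_det_pos(1)[of D Q s i l \<mu>] T_y_det_pos(1)[of D Q s i l \<mu>]
  by (auto simp: Uhat_x_def Uhat_y_def intro!: modify_admissible)

lemma xi_star_trace_x:
  assumes "\<mu> \<in> {1..nq D}" "(i + shift s, l) \<in> ext_cells D"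
  defines "\<xi> \<equiv> xi_star_x (T_x D Q s i l \<mu>) (trace_x D U s i l \<mu>)"
  shows "0 < \<xi>" "\<xi> * qform (Uhat_x D Q U s i l \<mu>) w z \<le> qform (trace_x D U s i l \<mu>) w z"
proof -
  note T = T_x_det_pos[OF trace_admissible(3)[OF assms(1,2)]]
  note xi = xi_star_x[OF trace_admissible(1)[OF assms(1,2)] less_imp_neq[OF T(1), symmetric] T(2,3)]
  show "0 < \<xi>" unfolding \<xi>_def by (rule xi)
  show "\<xi> * qform (Uhat_x D Q U s i l \<mu>) w z \<le> qform (trace_x D U s i l \<mu>) w z"
    unfolding \<xi>_def Uhat_x_def by (rule xi)
qed

lemma xi_star_trace_y:
  assumes "\<mu> \<in> {1..nq D}" "(i, l + shift s) \<in> ext_cells D"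
  defines "\<xi> \<equiv> xi_star_y (T_y D Q s i l \<mu>) (trace_y D U s i l \<mu>)"
  shows "0 < \<xi>" "\<xi> * qform (Uhat_y D Q U s i l \<mu>) w z \<le> qform (trace_y D U s i l \<mu>) w z"
proof -
  note T = T_y_det_pos[OF trace_admissible(4)[OF assms(1,2)]]
  note xi = xi_star_y[OF trace_admissible(2)[OF assms(1,2)] less_imp_neq[OF T(1), symmetric] T(2,3)]
  show "0 < \<xi>" unfolding \<xi>_def by (rule xi)
  show "\<xi> * qform (Uhat_y D Q U s i l \<mu>) w z \<le> qform (trace_y D U s i l \<mu>) w z"
    unfolding \<xi>_def Uhat_y_def by (rule xi)
qed

lemma ext_cellsI:
  assumes "(i, l) \<in> cells D"
  shows "(i, l) \<in> ext_cells D" "(i - 1, l) \<in> ext_cells D" "(i + 1, l) \<in> ext_cells D"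
    "(i, l - 1) \<in> ext_cells D" "(i, l + 1) \<in> ext_cells D"
  unfolding ext_cells_def using assms by (blast, (intro UnI2 UN_I[OF assms], simp)+)

context
  fixes i l :: int and \<mu> :: nat and w :: real and z :: "real^2" and dt :: real
  assumes cell: "(i, l) \<in> cells D" and \<mu>: "\<mu> \<in> {1..nq D}" and wz: "(w, z) \<noteq> 0" and dt: "0 < dt"
begin

lemma ext_cells_faces:
  "(i + shift Minus, l) \<in> ext_cells D" "(i + shift Plus, l) \<in> ext_cells D"
  "(i - 1 + shift Minus, l) \<in> ext_cells D" "(i - 1 + shift Plus, l) \<in> ext_cells D"
  "(i, l + shift Minus) \<in> ext_cells D" "(i, l + shift Plus) \<in> ext_cells D"
  "(i, l - 1 + shift Minus) \<in> ext_cells D" "(i, l - 1 + shift Plus) \<in> ext_cells D"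
  using ext_cellsI[OF cell] by simp_all

lemmas hat_x = ext_cells_faces(1-4)[THEN Uhat_admissible(1)[OF \<mu>]]
lemmas hat_y = ext_cells_faces(5-8)[THEN Uhat_admissible(2)[OF \<mu>]]

text \<open>The middle state is the inner trace at the right edge; its neighbours are the outer
  trace there and the inner trace at the left edge. The subtracted flux between the two inner traces
  reappears with opposite sign in \<open>flux_bound_L\<close>. The top and bottom edges are paired
  in the same way.\<close>

lemma flux_bound_R:
  assumes F: "flux_preserves_admissible F alpha1" and pos: "0 < dx D" "0 < om1m D"
    and \<theta>: "dt * (eta1_R D Q U i l \<mu> / (om1m D * dx D)) \<le> \<theta>"
  shows "0 < \<theta>"
    and "0 < \<theta> * (om1m D * qform (trace_x D U Minus i l \<mu>) w z) - dt / dx D *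
      (qform (face_flux_x D Q F U i l \<mu>) w z
       - qform (F (Uhat_x D Q U Plus (i - 1) l \<mu>) (Uhat_x D Q U Minus i l \<mu>)) w z)"
  unfolding face_flux_x_def
  by (rule flux_step[OF F hat_x(4,1,2) alpha_pos(1)[OF hat_x(1)] wz xi_star_trace_x[OF \<mu> ext_cells_faces(1)] dt pos insert_rotate_3
      \<theta>[unfolded eta1_R_def]])+

lemma flux_bound_L:
  assumes F: "flux_preserves_admissible F alpha1" and pos: "0 < dx D" "0 < om1p D"
    and \<theta>: "dt * (eta1_L D Q U i l \<mu> / (om1p D * dx D)) \<le> \<theta>"
  shows "0 < \<theta> * (om1p D * qform (trace_x D U Plus (i - 1) l \<mu>) w z) - dt / dx D *
      (qform (F (Uhat_x D Q U Plus (i - 1) l \<mu>) (Uhat_x D Q U Minus i l \<mu>)) w z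
       - qform (face_flux_x D Q F U (i - 1) l \<mu>) w z)"
  unfolding face_flux_x_def
  by (rule flux_step[OF F hat_x(3,4,1) alpha_pos(1)[OF hat_x(4)] wz xi_star_trace_x[OF \<mu> ext_cells_faces(4)] dt pos refl
      \<theta>[unfolded eta1_L_def]])+

lemma flux_bound_T:
  assumes G: "flux_preserves_admissible G alpha2" and pos: "0 < dy D" "0 < om2m D"
    and \<theta>: "dt * (eta2_T D Q U i l \<mu> / (om2m D * dy D)) \<le> \<theta>"
  shows "0 < \<theta> * (om2m D * qform (trace_y D U Minus i l \<mu>) w z) - dt / dy D *
      (qform (face_flux_y D Q G U i l \<mu>) w z
       - qform (G (Uhat_y D Q U Plus i (l - 1) \<mu>) (Uhat_y D Q U Minus i l \<mu>)) w z)"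
  unfolding face_flux_y_def
  by (rule flux_step[OF G hat_y(4,1,2) alpha_pos(2)[OF hat_y(1)] wz xi_star_trace_y[OF \<mu> ext_cells_faces(5)] dt pos insert_rotate_3
      \<theta>[unfolded eta2_T_def]])+

lemma flux_bound_B:
  assumes G: "flux_preserves_admissible G alpha2" and pos: "0 < dy D" "0 < om2p D"
    and \<theta>: "dt * (eta2_B D Q U i l \<mu> / (om2p D * dy D)) \<le> \<theta>"
  shows "0 < \<theta> * (om2p D * qform (trace_y D U Plus i (l - 1) \<mu>) w z) - dt / dy D *
      (qform (G (Uhat_y D Q U Plus i (l - 1) \<mu>) (Uhat_y D Q U Minus i l \<mu>)) w z
       - qform (face_flux_y D Q G U i (l - 1) \<mu>) w z)"
  unfolding face_flux_y_def
  by (rule flux_step[OF G hat_y(3,4,1) alpha_pos(2)[OF hat_y(4)] wz xi_star_trace_y[OF \<mu> ext_cells_faces(8)] dt pos refl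
      \<theta>[unfolded eta2_B_def]])+

end

end

text \<open>At each node the source is dominated by the maximal coefficient times the nodal state.
  Summing with nonnegative weights reproduces the form of the cell average by exactness of the
  quadrature, while the correction term is dominated by the average directly.\<close>

lemma source_bound:
  assumes S: "\<And>V. V \<in> admissible \<Longrightarrow> \<bar>qform (S V) w z\<bar> \<le> \<delta> V * qform V w z"
    and wt: "\<And>\<mu>. \<mu> \<in> {1..nq D} \<Longrightarrow> 0 \<le> wt D \<mu>"
    and adm: "\<And>\<mu>1 \<mu>2. \<mu>1 \<in> {1..nq D} \<Longrightarrow> \<mu>2 \<in> {1..nq D} \<Longrightarrow> at_gauss D U K \<mu>1 \<mu>2 \<in> admissible"
    and avg: "cell_avg D U K = (\<Sum>\<mu>1=1..nq D. \<Sum>\<mu>2=1..nq D. (wt D \<mu>1 * wt D \<mu>2) *\<^sub>R at_gauss D U K \<mu>1 \<mu>2)"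
      "cell_avg D U K \<in> admissible"
  shows "\<bar>qform ((\<Sum>\<mu>1=1..nq D. \<Sum>\<mu>2=1..nq D. (wt D \<mu>1 * wt D \<mu>2) *\<^sub>R
        at_gauss D (\<lambda>K x y. \<phi> K x y *\<^sub>R S (U K x y)) K \<mu>1 \<mu>2) + \<alpha> *\<^sub>R S (cell_avg D U K)) w z\<bar>
    \<le> ((MAX (\<mu>1, \<mu>2)\<in>{1..nq D} \<times> {1..nq D}. \<bar>at_gauss D (\<lambda>K x y. \<phi> K x y * \<delta> (U K x y)) K \<mu>1 \<mu>2\<bar>)
        + \<bar>\<alpha> * \<delta> (cell_avg D U K)\<bar>) * qform (cell_avg D U K) w z"
proof -
  let ?g = "\<lambda>\<mu>1 \<mu>2. \<bar>at_gauss D (\<lambda>K x y. \<phi> K x y * \<delta> (U K x y)) K \<mu>1 \<mu>2\<bar>"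
  define M where "M = (MAX (\<mu>1, \<mu>2)\<in>{1..nq D} \<times> {1..nq D}. ?g \<mu>1 \<mu>2)"
  have scaled: "\<bar>c * qform (S V) w z\<bar> \<le> \<bar>c * \<delta> V\<bar> * qform V w z" if "V \<in> admissible" for c V
  proof -
    have "\<bar>c * qform (S V) w z\<bar> \<le> \<bar>c\<bar> * (\<delta> V * qform V w z)"
      unfolding abs_mult by (intro mult_left_mono S that) simp
    \<comment> \<open>No sign of \<open>\<delta> V\<close> is assumed; the absolute value matches
      the one inside the beta terms.\<close>
    also have "\<dots> \<le> \<bar>c\<bar> * (\<bar>\<delta> V\<bar> * qform V w z)"
      using qform_nonneg[OF that] by (intro mult_left_mono mult_right_mono) simp_all
    finally show ?thesis by (simp add: abs_mult mult.assoc)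
  qed
  have node: "\<bar>qform (at_gauss D (\<lambda>K x y. \<phi> K x y *\<^sub>R S (U K x y)) K \<mu>1 \<mu>2) w z\<bar>
      \<le> M * qform (at_gauss D U K \<mu>1 \<mu>2) w z"
    if "\<mu>1 \<in> {1..nq D}" "\<mu>2 \<in> {1..nq D}" for \<mu>1 \<mu>2
  proof -
    have "?g \<mu>1 \<mu>2 \<le> M" unfolding M_def using that by (intro Max_ge) auto
    then have "?g \<mu>1 \<mu>2 * qform (at_gauss D U K \<mu>1 \<mu>2) w z \<le> M * qform (at_gauss D U K \<mu>1 \<mu>2) w z"
      using qform_nonneg[OF adm[OF that]] by (rule mult_right_mono)
    then show ?thesis
      using scaled[OF adm[OF that], of "at_gauss D \<phi> K \<mu>1 \<mu>2"] by (simp add: at_gauss_def)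
  qed
  have "\<bar>\<Sum>\<mu>1=1..nq D. \<Sum>\<mu>2=1..nq D. (wt D \<mu>1 * wt D \<mu>2) *
        qform (at_gauss D (\<lambda>K x y. \<phi> K x y *\<^sub>R S (U K x y)) K \<mu>1 \<mu>2) w z\<bar>
      \<le> (\<Sum>\<mu>1=1..nq D. \<Sum>\<mu>2=1..nq D. (wt D \<mu>1 * wt D \<mu>2) * (M * qform (at_gauss D U K \<mu>1 \<mu>2) w z))"
    using wt node
    by (intro order_trans[OF sum_abs] sum_mono) (simp add: abs_mult mult_left_mono)
  also have "\<dots> = M * qform (cell_avg D U K) w z"
    unfolding avg(1) by (simp add: sum_distrib_left mult_ac)
  finally show ?thesis
    using scaled[OF avg(2), of \<alpha>] unfolding M_def[symmetric] by (simp add: distrib_right)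
qed

section \<open>Assembly of the flux and source bounds in one cell\<close>

theorem theorem4p3:
  fixes k :: nat and D :: disc and Q :: equil and U :: "state broken"
    and Fhllc Ghllc :: "state \<Rightarrow> state \<Rightarrow> state" and dt :: real
  assumes k: "1 \<le> k"
    and mesh: "0 < dx D" "0 < dy D"
    and gauss: "gauss_rule D" "k \<le> 2 * nq D - 1"
    and decomposition: "feasible_decomposition D k"
    and flux: "flux_preserves_admissible Fhllc alpha1" "flux_preserves_admissible Ghllc alpha2"
    and equilibrium: "rho_e Q \<in> Vh D k" "p11_e Q \<in> Vh D k" "p22_e Q \<in> Vh D k"
    and solution: "U \<in> Vh_state D k"
    and equilibrium_pos:
      "\<forall>K\<in>ext_cells D. \<forall>(x, y)\<in>point_set D K. rho_e Q K x y > 0 \<and> pos_def (p_e Q K x y)"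
    and solution_adm:
      "\<forall>K\<in>ext_cells D. \<forall>(x, y)\<in>point_set D K. U K x y \<in> admissible"
    and dt: "0 < dt"
    and cfl: "\<forall>K\<in>cells D. cfl_condition D Q dt U K"
  shows "\<forall>K\<in>cells D. new_avg D Q Fhllc Ghllc dt U K \<in> admissible"
proof
  fix K assume K: "K \<in> cells D"
  obtain i l where Kil: "K = (i, l)" by (cases K)
  have cell: "(i, l) \<in> cells D" using K Kil by simp
  interpret admissible_data D Q U using equilibrium_pos solution_adm by unfold_locales
  note ext = ext_cellsI(1)[OF cell]
  \<comment> \<open>With no nodes the truncated difference would be 0, contradicting 1 \<le> k; so
    there is at least one node.\<close>
  have N: "1 \<in> {1..nq D}" and kN: "k < 2 * nq D" using k gauss(2) by auto
  have wt: "0 < wt D \<mu>" if "\<mu> \<in> {1..nq D}" for \<mu> using gauss(1) that by (auto simp: gauss_rule_def)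
  have om: "0 < om1m D" "0 < om1p D" "0 < om2m D" "0 < om2p D" "\<And>s. s \<in> {1..ns D} \<Longrightarrow> 0 < omt D s"
    using decomposition by (auto simp: feasible_decomposition_def)
  have node: "at_gauss D U (i, l) \<mu>1 \<mu>2 \<in> admissible" if "\<mu>1 \<in> {1..nq D}" "\<mu>2 \<in> {1..nq D}" for \<mu>1 \<mu>2
  proof -
    have "(xgauss D i \<mu>1, ygauss D l \<mu>2) \<in> point_set D (i, l)"
      unfolding point_set.simps by (rule UnI2) (use that in blast)
    from bspec[OF bspec[OF solution_adm ext] this] show ?thesis by (simp add: at_gauss_def)
  qed
  have inner: "U (i, l) (fst (pt D (i, l) s)) (snd (pt D (i, l) s)) \<in> admissible" if "s \<in> {1..ns D}" for s
  proof -
    have "pt D (i, l) s \<in> point_set D (i, l)"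
      unfolding point_set.simps by (intro UnI1 UnI2 imageI that)
    from bspec[OF bspec[OF solution_adm ext] this] show ?thesis by (simp add: case_prod_beta)
  qed
  let ?A = "cell_avg D U (i, l)"
  note avg = cell_avg_gauss[OF gauss(1) kN mesh solution ext]
  \<comment> \<open>By the tensor quadrature the average is a combination of admissible nodal states
    with positive weights.\<close>
  have A: "?A \<in> admissible"
    unfolding admissible_iff_qform
  proof (intro allI impI)
    fix w :: real and z :: "real^2" assume "(w, z) \<noteq> 0"
    then show "0 < qform ?A w z"
      unfolding avg qform_sum qform_linear using wt node N
      by (intro sum_pos mult_pos_pos) (auto simp: admissible_iff_qform)
  qed
  define E where "E = (\<Union>\<mu>\<in>{1..nq D}.
              {eta1_R D Q U i l \<mu> / (om1m D * dx D), eta1_L D Q U i l \<mu> / (om1p D * dx D),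
               eta2_T D Q U i l \<mu> / (om2m D * dy D), eta2_B D Q U i l \<mu> / (om2p D * dy D)})"
  define \<theta> where "\<theta> = dt * Max E"
  define b1 where "b1 = beta11 D Q U (i, l)"
  define b2 where "b2 = beta22 D Q U (i, l)"
  have cfl': "\<theta> + dt * b1 + dt * b2 \<le> 1"
    using cfl[rule_format, OF cell] by (simp add: E_def \<theta>_def b1_def b2_def algebra_simps)
  have \<theta>: "dt * e \<le> \<theta>" if "e \<in> E" for e
  proof -
    have "e \<le> Max E" by (rule Max_ge) (use that in \<open>simp_all add: E_def\<close>)
    then show ?thesis using dt by (simp add: \<theta>_def)
  qed
  have eta: "dt * (eta1_R D Q U i l \<mu> / (om1m D * dx D)) \<le> \<theta>" "dt * (eta1_L D Q U i l \<mu> / (om1p D * dx D)) \<le> \<theta>"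
    "dt * (eta2_T D Q U i l \<mu> / (om2m D * dy D)) \<le> \<theta>" "dt * (eta2_B D Q U i l \<mu> / (om2p D * dy D)) \<le> \<theta>"
    if "\<mu> \<in> {1..nq D}" for \<mu>
    by (rule \<theta>, unfold E_def, rule UN_I[OF that], simp)+
  have "new_avg D Q Fhllc Ghllc dt U (i, l) \<in> admissible"
    unfolding admissible_iff_qform
  proof (intro allI impI)
    fix w :: real and z :: "real^2" assume wz: "(w, z) \<noteq> 0"
    define L where "L = (\<lambda>V. qform V w z)"
    have L_linear: "L (V + W) = L V + L W" "L (V - W) = L V - L W" "L (c *\<^sub>R V) = c * L V"
      "L (sum g I) = (\<Sum>j\<in>I. L (g j))" for V W c and g :: "nat \<Rightarrow> state" and I
      by (simp_all add: L_def)
    have LA: "0 < L ?A" using A wz by (auto simp: L_def admissible_iff_qform)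
    \<comment> \<open>The inserted fluxes between the two inner traces; they cancel between opposite
      edges.\<close>
    define mx where "mx = (\<lambda>\<mu>. L (Fhllc (Uhat_x D Q U Plus (i - 1) l \<mu>) (Uhat_x D Q U Minus i l \<mu>)))"
    define my where "my = (\<lambda>\<mu>. L (Ghllc (Uhat_y D Q U Plus i (l - 1) \<mu>) (Uhat_y D Q U Minus i l \<mu>)))"
    define fx where "fx = (\<lambda>j \<mu>. L (face_flux_x D Q Fhllc U j l \<mu>))"
    define fy where "fy = (\<lambda>j \<mu>. L (face_flux_y D Q Ghllc U i j \<mu>))"
    define tR where "tR = (\<lambda>\<mu>. om1m D * L (trace_x D U Minus i l \<mu>))"
    define tL where "tL = (\<lambda>\<mu>. om1p D * L (trace_x D U Plus (i - 1) l \<mu>))"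
    define tT where "tT = (\<lambda>\<mu>. om2m D * L (trace_y D U Minus i l \<mu>))"
    define tB where "tB = (\<lambda>\<mu>. om2p D * L (trace_y D U Plus i (l - 1) \<mu>))"
    define I where "I = (\<Sum>s=1..ns D. omt D s * L (U (i, l) (fst (pt D (i, l) s)) (snd (pt D (i, l) s))))"
    note defs = mx_def my_def fx_def fy_def tR_def tL_def tT_def tB_def L_def
    have \<theta>_pos: "0 < \<theta>"
      using flux_bound_R(1)[OF cell N wz dt flux(1) mesh(1) om(1) eta(1)[OF N]] .
    have I: "0 \<le> I" unfolding I_def L_def
      using om(5) inner by (intro sum_nonneg mult_nonneg_nonneg) (auto intro: less_imp_le qform_nonneg)
    have avg_decomp: "L ?A = (\<Sum>\<mu>=1..nq D. wt D \<mu> * (tR \<mu> + tL \<mu> + tT \<mu> + tB \<mu>)) + I"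
      unfolding cell_avg_feasible[OF decomposition solution ext] L_linear tR_def tL_def tT_def tB_def I_def ..
    have term_pos: "0 < (\<theta> * tR \<mu> - dt / dx D * (fx i \<mu> - mx \<mu>)) + (\<theta> * tL \<mu> - dt / dx D * (mx \<mu> - fx (i - 1) \<mu>))
       + (\<theta> * tT \<mu> - dt / dy D * (fy l \<mu> - my \<mu>)) + (\<theta> * tB \<mu> - dt / dy D * (my \<mu> - fy (l - 1) \<mu>))"
      (is "0 < ?t \<mu>") if \<mu>: "\<mu> \<in> {1..nq D}" for \<mu>
      unfolding defs
      by (intro add_pos_pos flux_bound_R(2)[OF cell \<mu> wz dt flux(1) mesh(1) om(1) eta(1)[OF \<mu>]]
          flux_bound_L[OF cell \<mu> wz dt flux(1) mesh(1) om(2) eta(2)[OF \<mu>]]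
          flux_bound_T[OF cell \<mu> wz dt flux(2) mesh(2) om(3) eta(3)[OF \<mu>]]
          flux_bound_B[OF cell \<mu> wz dt flux(2) mesh(2) om(4) eta(4)[OF \<mu>]])
    define X where "X = dt / dx D * (\<Sum>\<mu>=1..nq D. wt D \<mu> * (fx i \<mu> - fx (i - 1) \<mu>))"
    define Y where "Y = dt / dy D * (\<Sum>\<mu>=1..nq D. wt D \<mu> * (fy l \<mu> - fy (l - 1) \<mu>))"
    have "0 < (\<Sum>\<mu>=1..nq D. wt D \<mu> * ?t \<mu>)"
      using term_pos wt N by (intro sum_pos mult_pos_pos) auto
    \<comment> \<open>The \<open>mx\<close> and \<open>my\<close> terms cancel here, leaving the
      flux differences of the scheme.\<close>
    also have "\<dots> = (\<Sum>\<mu>=1..nq D. \<theta> * (wt D \<mu> * (tR \<mu> + tL \<mu> + tT \<mu> + tB \<mu>))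
        - dt / dx D * (wt D \<mu> * (fx i \<mu> - fx (i - 1) \<mu>)) - dt / dy D * (wt D \<mu> * (fy l \<mu> - fy (l - 1) \<mu>)))"
      by (intro sum.cong refl) (simp add: algebra_simps)
    also have "\<dots> = \<theta> * (L ?A - I) - X - Y"
      by (simp only: X_def Y_def avg_decomp sum_subtractf sum_distrib_left add_diff_cancel_right')
    finally have flux_part: "0 < \<theta> * (L ?A - I) - X - Y" .
    have "\<bar>L (source_x D Q U (i, l))\<bar> \<le> b1 * L ?A"
      unfolding source_x_def b1_def beta11_def L_def
      by (rule source_bound[OF qform_S1_le less_imp_le[OF wt] node avg A])
    then have sx: "- (dt * b1 * L ?A) \<le> dt * L (source_x D Q U (i, l))"
      using dt mult_left_mono[of "- (b1 * L ?A)" "L (source_x D Q U (i, l))" dt] by (simp add: mult.assoc)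
    have "\<bar>L (source_y D Q U (i, l))\<bar> \<le> b2 * L ?A"
      unfolding source_y_def b2_def beta22_def L_def
      by (rule source_bound[OF qform_S2_le less_imp_le[OF wt] node avg A])
    then have sy: "- (dt * b2 * L ?A) \<le> dt * L (source_y D Q U (i, l))"
      using dt mult_left_mono[of "- (b2 * L ?A)" "L (source_y D Q U (i, l))" dt] by (simp add: mult.assoc)
    \<comment> \<open>The update is bounded below by the sum of \<open>flux_part\<close>, \<theta> I
      and (1 - \<theta> - dt b1 - dt b2) L A. The first is positive, and the other two are
      nonnegative.\<close>
    have "(\<theta> + dt * b1 + dt * b2) * L ?A \<le> 1 * L ?A"
      using cfl' LA by (intro mult_right_mono) simp_all
    moreover have "0 \<le> \<theta> * I" using \<theta>_pos I by simp
    moreover have "L (new_avg D Q Fhllc Ghllc dt U (i, l)) =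
        L ?A - X - Y + dt * L (source_x D Q U (i, l)) + dt * L (source_y D Q U (i, l))"
      unfolding new_avg.simps L_linear X_def Y_def fx_def fy_def ..
    moreover note flux_part sx sy
    ultimately have "0 < L (new_avg D Q Fhllc Ghllc dt U (i, l))"
      unfolding distrib_right right_diff_distrib[of \<theta>] by linarith
    then show "0 < qform (new_avg D Q Fhllc Ghllc dt U (i, l)) w z" by (simp add: L_def)
  qed
  then show "new_avg D Q Fhllc Ghllc dt U K \<in> admissible" by (simp add: Kil)
qed

end
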